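(* There are infinitely many natural numbers $n$ for which $$\pi(n)=\frac{n}{\left\lfloor \ln n-\frac{1}{2}\right\rfloor},$$ where $\pi(n)$ denotes the number of primes not greater than $n$.
   Context: $\pi(n)$ is the prime counting function (the number of primes $p\le n$), $\ln$ is the natural logarithm, and $\lfloor x\rfloor$ is the greatest integer not exceeding $x$. *)

theory Defs
  imports Complex_Main "HOL-Computational_Algebra.Primes"
begin

definition prime_pi :: "nat \<Rightarrow> nat" where
  "prime_pi n = card {p :: nat. prime p \<and> p \<le> n}"

end

theory Submission
  imports Defs "HOL-Complex_Analysis.Complex_Analysis" "HOL-Number_Theory.Prime_Powers"
    "HOL-Real_Asymp.Real_Asymp"
begin

text \<open>
  Write \<open>F n = \<lfloor>ln n - 1/2\<rfloor>\<close>. The integer sequence \<open>g n = \<pi>(n) F n - n\<close> decreases by at most 1 per step, so if it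
  had only finitely many zeros it would eventually have constant sign, and so would
  \<open>a n = n / F n - \<pi>(n)\<close>. This is refuted by an argument in the style of Landau's theorem on Dirichlet
  series with nonnegative coefficients, applied to \<open>H(z) = \<Sum>n. a n \<cdot> ln n \<cdot> n powr (-z-2)\<close>. As
  \<open>\<sigma> \<rightarrow> 0+\<close>, the singular parts of the two halves of \<open>H(\<sigma>)\<close> cancel down to
  \<open>O(1)\<close>: the shift \<open>1/2\<close> makes \<open>F n\<close> equal to \<open>ln n - 1\<close> on average, in accordance with
  \<open>\<pi>(x) \<approx> x / (ln x - 1)\<close>. Constant sign then forces \<open>H(\<sigma> + 2\<pi>i) = O(1)\<close> as well. But \<open>F n\<close> is constant on
  blocks of length 1 in \<open>ln n\<close>, so the floor half has a logarithmic singularity at \<open>2\<pi>i\<close>,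
  whereas the prime half, a multiple of \<open>\<zeta>'/\<zeta>\<close> up to lower order, is there either bounded or of order \<open>1/\<sigma>\<close>.
\<close>

section \<open>Dirichlet series and the zeta function near the line Re s = 1\<close>

text \<open>The weight \<open>ln n\<close> serves both halves. Over the primes it produces a
  logarithmic derivative, whose pole has a coefficient that can be read off. Over the floor it meets
  the factor \<open>1/k\<close> on the k-th block as (k + 1/2)/k = 1 + 1/(2k), so that the block sum
  is a geometric series plus a logarithm, in closed form. All remaining errors are bounded uniformly
  in Re z > 0 as long as norm z is bounded, so only the explicit main terms have to be compared as
  sigma tends to 0. The constant 1/2 is forced by this comparison: with a shift c in its place, the
  floor half would be 1/sigma - (c + 1/2) ln sigma + O(1), while the prime half is 1/sigma - ln
  sigma + O(1). The point 2 pi i comes from the period of exp: the floor half depends on z partly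
  through exp(-z), so the branch point of the logarithm at 0 recurs there. The prime half has no
  such period. At 1 + 2 pi i it can at worst have a pole of its logarithmic derivative, and a pole
  and a lone logarithm cannot cancel.\<close>

lemma norm_of_nat_powr: "norm (of_nat n powr s :: complex) = real n powr Re s"
  by (simp add: norm_powr_real_powr)

lemma norm_of_real_powr: "x \<ge> 0 \<Longrightarrow> norm (of_real x powr s :: complex) = x powr Re s"
  by (simp add: norm_powr_real_powr)

lemma summable_ln_powr:
  fixes a :: real
  assumes "a < -1"
  shows "summable (\<lambda>n. ln (real n) * real n powr a)"
proof (rule summable_comparison_test_bigo)
  define e where "e = - 1 - a"
  have e: "e > 0" and a: "a = -1 - e" using assms by (auto simp: e_def)
  show "summable (\<lambda>n. norm (real n powr (-1 - e/2)))"
    using e by (simp add: summable_real_powr_iff)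
  show "(\<lambda>n. ln (real n) * real n powr a) \<in> O(\<lambda>n. real n powr (-1 - e/2))"
    unfolding a using e by real_asymp
qed

text \<open>First-order Taylor expansion along a real segment. It shows that a difference over a
  unit step equals the derivative at its left end up to the second derivative, which for complex
  powers is smaller by another factor of about \<open>1/x\<close>. That gain makes the later error
  series converge.\<close>

lemma taylor_unit_step:
  fixes f f' f'' :: "complex \<Rightarrow> complex" and x B :: real
  assumes "\<And>t. t \<in> {x..x+1} \<Longrightarrow> (f has_field_derivative f' (of_real t)) (at (of_real t))"
    and "\<And>t. t \<in> {x..x+1} \<Longrightarrow> (f' has_field_derivative f'' (of_real t)) (at (of_real t))"
    and "\<And>t. t \<in> {x..x+1} \<Longrightarrow> norm (f'' (of_real t)) \<le> B"
  shows "norm (f (of_real (x + 1)) - f (of_real x) - f' (of_real x)) \<le> B"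
proof -
  define F where "F = (\<lambda>i::nat. if i = 0 then f else if i = 1 then f' else f'')"
  define S :: "complex set" where "S = closed_segment (of_real x) (of_real (x + 1))"
  have S: "S = of_real ` {x..x+1}"
    unfolding S_def closed_segment_of_real by (simp add: closed_segment_eq_real_ivl)
  have "norm (F 0 (of_real (x+1)) - (\<Sum>i\<le>1. F i (of_real x) * (of_real (x+1) - of_real x) ^ i / fact i))
          \<le> B * norm (of_real (x+1) - of_real x :: complex) ^ Suc 1 / fact 1"
  proof (rule complex_Taylor[where S = S])
    show "convex S" by (simp add: S_def)
    show "of_real x \<in> S" "of_real (x+1) \<in> S" by (auto simp: S_def)
    show "norm (F (Suc 1) w) \<le> B" if "w \<in> S" for w
      using that assms(3) by (auto simp: S F_def)
    show "(F i has_field_derivative F (Suc i) w) (at w within S)" if "w \<in> S" "i \<le> 1" for i w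
    proof -
      obtain t where t: "t \<in> {x..x+1}" "w = of_real t" using \<open>w \<in> S\<close> by (auto simp: S)
      from \<open>i \<le> 1\<close> have "i = 0 \<or> i = 1" by auto
      thus ?thesis using assms(1,2)[OF t(1)] t(2)
        by (auto simp: F_def intro: has_field_derivative_at_within)
    qed
  qed
  thus ?thesis by (simp add: F_def algebra_simps)
qed

text \<open>Locally uniform domination by a convergent series allows termwise differentiation.
  Coefficients bounded by 1 cover both uses: the constant 1 for zeta and the indicator of the
  primes.\<close>

lemma dirichlet_has_field_derivative:
  fixes a :: "nat \<Rightarrow> complex" and s :: complex
  assumes a: "\<And>n. norm (a n) \<le> 1" and s: "Re s > 1"
  shows "(\<lambda>n. a n * of_nat n powr (-s)) sums (\<Sum>n. a n * of_nat n powr (-s))"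
    and "(\<lambda>n. a n * of_real (ln n) * of_nat n powr (-s)) sums (\<Sum>n. a n * of_real (ln n) * of_nat n powr (-s))"
    and "((\<lambda>s. \<Sum>n. a n * of_nat n powr (-s)) has_field_derivative
            -(\<Sum>n. a n * of_real (ln n) * of_nat n powr (-s))) (at s)"
proof -
  define S where "S = {s::complex. Re s > 1}"
  have S: "open S" unfolding S_def by (rule open_halfspace_Re_gt)
  have sS: "s \<in> S" using s by (simp add: S_def)
  have "\<exists>g g'. \<forall>x\<in>S. ((\<lambda>n. a n * of_nat n powr (-x)) sums g x) \<and>
          ((\<lambda>n. - (a n * of_real (ln n) * of_nat n powr (-x))) sums g' x) \<and> (g has_field_derivative g' x) (at x)"
  proof (rule series_and_derivative_comparison_local[OF S])
    fix n x assume "x \<in> S"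
    show "((\<lambda>x. a n * of_nat n powr (-x)) has_field_derivative
            - (a n * of_real (ln n) * of_nat n powr (-x))) (at x)"
    proof (cases "n = 0")
      case True thus ?thesis by simp
    next
      case False
      hence "of_nat n \<noteq> (0::complex)" by simp
      hence "((\<lambda>x. of_nat n powr (-x)) has_field_derivative (- (Ln (of_nat n) * of_nat n powr (-x)))) (at x)"
        by (auto simp: powr_def intro!: derivative_eq_intros)
      from DERIV_cmult[OF this, of "a n"] False show ?thesis by (simp add: algebra_simps)
    qed
  next
    fix x assume x: "x \<in> S"
    \<comment> \<open>Half the distance to the line Re s = 1, so the ball of radius \<open>d\<close>
      stays in Re y \<ge> 1 + d.\<close>
    define d where "d = (Re x - 1) / 2"
    have d: "d > 0" using x by (simp add: d_def S_def)
    define h where "h = (\<lambda>n::nat. real n powr (- 1 - d))"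
    have "summable h" using d by (simp add: h_def summable_real_powr_iff)
    moreover have "norm (a n * of_nat n powr (-y)) \<le> h n" if "y \<in> ball x d \<inter> S" for n y
    proof (cases "n = 0")
      case False
      have "\<bar>Re (x - y)\<bar> < d" using that abs_Re_le_cmod[of "x - y"] by (simp add: dist_norm)
      hence "Re y \<ge> 1 + d" unfolding d_def minus_complex.simps abs_less_iff by argo
      hence "real n powr (- Re y) \<le> h n" using False unfolding h_def by (intro powr_mono) auto
      moreover have "norm (a n * of_nat n powr (-y)) \<le> 1 * real n powr (- Re y)"
        unfolding norm_mult norm_of_nat_powr by (intro mult_mono a) auto
      ultimately show ?thesis by simp
    qed (simp add: h_def)
    ultimately show "\<exists>d h. 0 < d \<and> summable h \<and>
      (\<forall>\<^sub>F n in sequentially. \<forall>y\<in>ball x d \<inter> S. norm (a n * of_nat n powr (-y)) \<le> h n)"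
      using d by (intro exI[of _ d] exI[of _ h]) auto
  qed
  then obtain g g' where g: "\<And>x. x \<in> S \<Longrightarrow> (\<lambda>n. a n * of_nat n powr (-x)) sums g x"
    "\<And>x. x \<in> S \<Longrightarrow> (\<lambda>n. - (a n * of_real (ln n) * of_nat n powr (-x))) sums g' x"
    "\<And>x. x \<in> S \<Longrightarrow> (g has_field_derivative g' x) (at x)" by blast
  show 1: "(\<lambda>n. a n * of_nat n powr (-s)) sums (\<Sum>n. a n * of_nat n powr (-s))"
    using g(1)[OF sS] by (simp add: sums_iff)
  have 3: "(\<lambda>n. a n * of_real (ln n) * of_nat n powr (-s)) sums - g' s"
    using sums_minus[OF g(2)[OF sS]] by simp
  thus 2: "(\<lambda>n. a n * of_real (ln n) * of_nat n powr (-s)) sums (\<Sum>n. a n * of_real (ln n) * of_nat n powr (-s))"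
    by (simp add: sums_iff)
  have eq: "g' s = -(\<Sum>n. a n * of_real (ln n) * of_nat n powr (-s))"
    using 3 by (simp add: sums_iff)
  show "((\<lambda>s. \<Sum>n. a n * of_nat n powr (-s)) has_field_derivative
            -(\<Sum>n. a n * of_real (ln n) * of_nat n powr (-s))) (at s)"
    unfolding eq[symmetric]
  proof (rule has_field_derivative_transform_within_open[OF g(3)[OF sS] S sS])
    show "g x = (\<Sum>n. a n * of_nat n powr (-x))" if "x \<in> S" for x
      using g(1)[OF that] by (simp add: sums_iff)
  qed
qed

text \<open>Summing these terms over \<open>n \<ge> 1\<close> gives \<open>(s - 1) \<zeta>(s) - 1\<close> for \<open>Re s > 1\<close> by
  telescoping; they are \<open>O(n powr (- Re s - 1))\<close>, which continues the sum to \<open>Re s > 0\<close>.\<close>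

definition zeta_term :: "nat \<Rightarrow> complex \<Rightarrow> complex" where
  "zeta_term n s = (if n = 0 then 0 else
     (s - 1) * of_nat n powr (-s) + of_nat (Suc n) powr (1 - s) - of_nat n powr (1 - s))"

text \<open>Up to sign conventions \<open>zeta_term n s\<close> is the Taylor remainder of w powr (1
  - s) over the step from n to n + 1, and s (s - 1) w powr (-s - 1) is the second derivative of that
  function.\<close>

lemma norm_zeta_term_le:
  assumes "Re s \<ge> 0"
  shows "norm (zeta_term n s) \<le> norm (s * (s - 1)) * real n powr (-Re s - 1)"
proof (cases "n = 0")
  case False
  define x where "x = real n"
  have x: "x \<ge> 1" using False by (simp add: x_def)
  have "norm ((of_real (x + 1) :: complex) powr (1 - s) - of_real x powr (1 - s) -
          (1 - s) * of_real x powr (-s)) \<le> norm (s * (s - 1)) * x powr (-Re s - 1)"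
  proof (rule taylor_unit_step[where f = "\<lambda>w. w powr (1-s)" and f' = "\<lambda>w. (1-s) * w powr (-s)"
        and f'' = "\<lambda>w. (1-s) * (-s) * w powr (-s-1)"])
    fix t assume t: "t \<in> {x..x+1}"
    have t0: "t > 0" using t x by auto
    hence nz: "complex_of_real t \<notin> \<real>\<^sub>\<le>\<^sub>0" by (simp add: complex_nonpos_Reals_iff)
    show "((\<lambda>w. w powr (1-s)) has_field_derivative (1-s) * complex_of_real t powr (-s)) (at (of_real t))"
      using nz by (auto intro!: derivative_eq_intros)
    show "((\<lambda>w. (1-s) * w powr (-s)) has_field_derivative (1-s) * (-s) * complex_of_real t powr (-s-1)) (at (of_real t))"
      using nz by (auto intro!: derivative_eq_intros)
    have "norm ((1-s) * (-s) * complex_of_real t powr (-s-1)) = norm (s * (s-1)) * t powr (-Re s - 1)"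
      using t0 by (simp add: norm_mult norm_of_real_powr norm_minus_commute)
    also have "\<dots> \<le> norm (s * (s-1)) * x powr (-Re s - 1)"
      using t x assms by (intro mult_left_mono powr_mono2') auto
    finally show "norm ((1-s) * (-s) * complex_of_real t powr (-s-1)) \<le> norm (s * (s-1)) * x powr (-Re s - 1)" .
  qed
  thus ?thesis using False by (simp add: zeta_term_def x_def algebra_simps)
qed (simp add: zeta_term_def)

text \<open>This is (s - 1) zeta(s), continued to Re s > 0. Removing the pole makes the point 1 an
  ordinary point with value 1, and the pole reappears only as an explicit \<open>1 / (s - 1)\<close>
  in the logarithmic derivative.\<close>

definition psi :: "complex \<Rightarrow> complex" where
  "psi s = 1 + (\<Sum>n. zeta_term n s)"

lemma psi_1: "psi 1 = 1"
proof -
  have "zeta_term n 1 = 0" for n by (simp add: zeta_term_def del: of_nat_Suc)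
  thus ?thesis by (simp add: psi_def)
qed

lemma psi_holomorphic: "psi holomorphic_on {s. Re s > 0}"
proof -
  define S where "S = {s::complex. Re s > 0}"
  have S: "open S" unfolding S_def by (rule open_halfspace_Re_gt)
  have "\<exists>g g'. \<forall>x\<in>S. (\<lambda>n. zeta_term n x) sums g x \<and>
          (\<lambda>n. deriv (zeta_term n) x) sums g' x \<and> (g has_field_derivative g' x) (at x)"
  proof (rule series_and_derivative_comparison_local[OF S])
    fix n x assume "x \<in> S"
    have "zeta_term n holomorphic_on UNIV"
    proof (cases "n = 0")
      case True thus ?thesis by (simp add: zeta_term_def[abs_def])
    next
      case False
      hence "of_nat n \<noteq> (0::complex)" "of_nat (Suc n) \<noteq> (0::complex)" by (simp_all del: of_nat_Suc)
      thus ?thesis using False unfolding zeta_term_def[abs_def]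
        by (auto intro!: holomorphic_intros simp del: of_nat_Suc)
    qed
    thus "(zeta_term n has_field_derivative deriv (zeta_term n) x) (at x)"
      by (intro holomorphic_derivI[of _ UNIV]) auto
  next
    fix x assume x: "x \<in> S"
    define d where "d = Re x / 2"
    have d: "d > 0" using x by (simp add: d_def S_def)
    define C where "C = (norm x + d) * (norm x + d + 1)"
    define h where "h = (\<lambda>n::nat. C * real n powr (- 1 - d))"
    have "summable h" using d by (auto simp: h_def summable_real_powr_iff intro!: summable_mult)
    moreover have "norm (zeta_term n y) \<le> h n" if "y \<in> ball x d \<inter> S" for n y
    proof (cases "n = 0")
      case False
      have yd: "norm (x - y) < d" using that by (simp add: dist_norm)
      have "\<bar>Re (x - y)\<bar> < d" using yd abs_Re_le_cmod[of "x - y"] by simp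
      hence "Re y \<ge> d" unfolding d_def minus_complex.simps abs_less_iff by argo
      hence 1: "real n powr (- Re y - 1) \<le> real n powr (-1-d)" using False by (intro powr_mono) auto
      have "norm y \<le> norm x + d" using yd norm_triangle_sub[of y x] by (simp add: norm_minus_commute)
      moreover from this have "norm (y - 1) \<le> norm x + d + 1" using norm_triangle_ineq4[of y 1] by simp
      ultimately have 2: "norm (y * (y - 1)) \<le> C" unfolding norm_mult C_def using d by (intro mult_mono) (auto intro: add_nonneg_nonneg)
      have "norm (zeta_term n y) \<le> norm (y * (y - 1)) * real n powr (-Re y - 1)"
        using that by (intro norm_zeta_term_le) (auto simp: S_def)
      also have "\<dots> \<le> h n" unfolding h_def using d by (intro mult_mono 1 2) (auto simp: C_def)
      finally show ?thesis .
    qed (simp add: h_def zeta_term_def)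
    ultimately show "\<exists>d h. 0 < d \<and> summable h \<and>
      (\<forall>\<^sub>F n in sequentially. \<forall>y\<in>ball x d \<inter> S. norm (zeta_term n y) \<le> h n)"
      using d by (intro exI[of _ d] exI[of _ h]) auto
  qed
  then obtain g g' where g: "\<And>x. x \<in> S \<Longrightarrow> (\<lambda>n. zeta_term n x) sums g x"
    "\<And>x. x \<in> S \<Longrightarrow> (g has_field_derivative g' x) (at x)" by blast
  have "g holomorphic_on S" using g(2) S by (auto simp: holomorphic_on_open)
  hence "(\<lambda>s. 1 + g s) holomorphic_on S" by (intro holomorphic_intros)
  also have "?this \<longleftrightarrow> psi holomorphic_on S"
    by (intro holomorphic_cong refl) (use g(1) in \<open>auto simp: psi_def sums_iff\<close>)
  finally show ?thesis by (simp add: S_def)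
qed

lemma psi_eq_zeta:
  assumes s: "Re s > 1"
  shows "psi s = (s - 1) * (\<Sum>n. of_nat n powr (-s))"
proof -
  have "(\<lambda>n. 1 * of_nat n powr (-s)) sums (\<Sum>n. 1 * of_nat n powr (-s) :: complex)"
    by (rule dirichlet_has_field_derivative(1)[of "\<lambda>_. 1"]) (use s in auto)
  hence "(\<lambda>N. (s-1) * (\<Sum>n<N. of_nat n powr (-s))) \<longlonglongrightarrow> (s-1) * (\<Sum>n. of_nat n powr (-s))"
    unfolding sums_def mult_1 by (rule tendsto_mult_left)
  moreover have "(\<lambda>N. (of_nat N :: complex) powr (1-s)) \<longlonglongrightarrow> 0"
  proof (rule tendsto_norm_zero_cancel)
    have "(\<lambda>N. real N powr (1 - Re s)) \<longlonglongrightarrow> 0"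
      by (intro tendsto_neg_powr filterlim_real_sequentially) (use s in auto)
    thus "(\<lambda>N. norm ((of_nat N :: complex) powr (1-s))) \<longlonglongrightarrow> 0"
      by (simp add: norm_of_nat_powr)
  qed
  ultimately have lim: "(\<lambda>N. (s-1) * (\<Sum>n<N. of_nat n powr (-s)) + of_nat N powr (1-s) - 1) \<longlonglongrightarrow>
         (s-1) * (\<Sum>n. of_nat n powr (-s)) + 0 - 1"
    by (intro tendsto_diff tendsto_add tendsto_const)
  \<comment> \<open>The telescoping starts at n = 1, as the term at 0 is set to 0; the -1 is its
    lower end 1 powr (1 - s).\<close>
  have "(\<Sum>n<Suc N. zeta_term n s) = (s-1) * (\<Sum>n<Suc N. of_nat n powr (-s)) + of_nat (Suc N) powr (1-s) - 1" for N
    by (induction N) (simp_all add: zeta_term_def algebra_simps del: of_nat_Suc, simp_all)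
  hence "(\<lambda>N. \<Sum>n<Suc N. zeta_term n s) \<longlonglongrightarrow> (s-1) * (\<Sum>n. of_nat n powr (-s)) + 0 - 1"
    using LIMSEQ_Suc[OF lim] by presburger
  hence "(\<lambda>n. zeta_term n s) sums ((s-1) * (\<Sum>n. of_nat n powr (-s)) - 1)"
    unfolding sums_def by (subst (asm) filterlim_sequentially_Suc) simp
  thus ?thesis by (simp add: psi_def sums_iff)
qed

text \<open>Near \<open>z0\<close> write f = h (z - z0)^m with h holomorphic and free of zeros; then
  g is h'/h. The point \<open>w\<close> with \<open>f w \<noteq> 0\<close> and the connectedness of
  S exclude a zero of infinite order.\<close>

lemma logderiv_dichotomy:
  assumes "f holomorphic_on S" "open S" "connected S" "z0 \<in> S" "w \<in> S" "f w \<noteq> 0"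
  shows "\<exists>m g r. r > 0 \<and> continuous_on (cball z0 r) g \<and>
           (\<forall>z\<in>cball z0 r - {z0}. f z \<noteq> 0 \<and> deriv f z / f z = of_nat m / (z - z0) + g z) \<and>
           (f z0 \<noteq> 0 \<longrightarrow> m = 0)"
proof -
  define m where "m = nat (zorder f z0)"
  define h where "h = zor_poly f z0"
  have *: "(if f z0=0 then zorder f z0 > 0 else zorder f z0=0) \<and> (\<exists>r. r>0 \<and> cball z0 r \<subseteq> S \<and> h holomorphic_on cball z0 r
    \<and> (\<forall>w\<in>cball z0 r. f w  = h w * (w-z0) ^ m \<and> h w \<noteq>0))"
    unfolding m_def h_def by (rule zorder_exist_zero[OF assms(1-4)]) (use assms in auto)
  from conjunct2[OF *] obtain r where r: "r > 0" "cball z0 r \<subseteq> S" "h holomorphic_on cball z0 r"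
    "\<And>w. w\<in>cball z0 r \<Longrightarrow> f w  = h w * (w-z0) ^ m \<and> h w \<noteq>0"
    by metis
  from conjunct1[OF *] have m: "f z0 \<noteq> 0 \<longrightarrow> m = 0"
    by (simp add: m_def)
  have h: "h holomorphic_on ball z0 r" by (rule holomorphic_on_subset[OF r(3)]) auto
  have sub: "cball z0 (r/2) \<subseteq> ball z0 r" using r(1) by auto
  show ?thesis
  proof (intro exI[of _ m] exI[of _ "\<lambda>z. deriv h z / h z"] exI[of _ "r/2"] conjI ballI)
    show "r/2 > 0" using r by simp
    have "(\<lambda>z. deriv h z / h z) holomorphic_on ball z0 r"
      using r(4) by (intro holomorphic_intros holomorphic_deriv h) auto
    hence "continuous_on (ball z0 r) (\<lambda>z. deriv h z / h z)" by (rule holomorphic_on_imp_continuous_on)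
    thus "continuous_on (cball z0 (r/2)) (\<lambda>z. deriv h z / h z)" using sub by (rule continuous_on_subset)
    show "f z0 \<noteq> 0 \<longrightarrow> m = 0" by fact
    fix z assume z: "z \<in> cball z0 (r/2) - {z0}"
    hence zb: "z \<in> ball z0 r" "z \<in> cball z0 r" using sub by auto
    show "f z \<noteq> 0" using r(4)[OF zb(2)] z by auto
    have "(h has_field_derivative deriv h z) (at z)" using h zb by (intro holomorphic_derivI[of _ "ball z0 r"]) auto
    hence "((\<lambda>w. h w * (w - z0) ^ m) has_field_derivative
              deriv h z * (z - z0) ^ m + h z * (of_nat m * (z-z0)^(m-1))) (at z)"
      by (auto intro!: derivative_eq_intros)
    hence "(f has_field_derivative deriv h z * (z - z0) ^ m + h z * (of_nat m * (z-z0)^(m-1))) (at z)"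
      by (rule has_field_derivative_transform_within_open[of _ _ _ "ball z0 r"]) (use r(4) zb in auto)
    hence D: "deriv f z = deriv h z * (z - z0) ^ m + h z * (of_nat m * (z-z0)^(m-1))"
      by (rule DERIV_imp_deriv)
    have hz: "h z \<noteq> 0" "f z = h z * (z - z0)^m" using r(4)[OF zb(2)] by auto
    show "deriv f z / f z = of_nat m / (z - z0) + deriv h z / h z"
      using z hz(1) unfolding D hz(2) by (cases m) (auto simp: field_simps)
  qed
qed

section \<open>Sums over primes\<close>

text \<open>The product is an absolutely convergent double series over pairs (d, m), regrouped by n
  = d m. The vanishing at 0 discards the pairs with a zero component, for which d cannot be
  recovered as a divisor of a positive n.\<close>

lemma dirichlet_product_sums:
  fixes f g :: "nat \<Rightarrow> complex"
  assumes f: "summable (\<lambda>n. norm (f n))" and g: "summable (\<lambda>n. norm (g n))"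
    and f0: "f 0 = 0" and g0: "g 0 = 0"
  shows "(\<lambda>n. \<Sum>d | d dvd n. f d * g (n div d)) sums (suminf f * suminf g)"
proof -
  have fs: "(f has_sum suminf f) UNIV"
    by (rule norm_summable_imp_has_sum[OF f summable_sums[OF summable_norm_cancel[OF f]]])
  have gs: "(g has_sum suminf g) UNIV"
    by (rule norm_summable_imp_has_sum[OF g summable_sums[OF summable_norm_cancel[OF g]]])
  define F where "F = (\<lambda>(d, m). f d * g m)"
  have fn: "(\<lambda>n. norm (f n)) summable_on UNIV" and gn: "(\<lambda>n. norm (g n)) summable_on UNIV"
    using f g by (auto intro!: norm_summable_imp_summable_on)
  have "(\<lambda>x. norm (F x)) summable_on Sigma UNIV (\<lambda>_. UNIV)"
    unfolding Infinite_Sum.abs_summable_on_Sigma_iff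
  proof (intro conjI ballI)
    fix d show "(\<lambda>m. norm (F (d, m))) summable_on UNIV"
      unfolding F_def by (auto simp: norm_mult intro!: summable_on_cmult_right gn)
  next
    have "infsum (\<lambda>m. norm (F (d, m))) UNIV = norm (f d) * infsum (\<lambda>m. norm (g m)) UNIV" for d
      unfolding F_def by (simp add: norm_mult infsum_cmult_right')
    moreover have "infsum (\<lambda>m. norm (g m)) UNIV \<ge> 0" by (intro infsum_nonneg) auto
    ultimately show "(\<lambda>d. norm (infsum (\<lambda>m. norm (F (d, m))) UNIV)) summable_on UNIV"
      using fn by (auto intro!: summable_on_cmult_left)
  qed
  hence "F summable_on Sigma UNIV (\<lambda>_. UNIV)" by (rule abs_summable_summable)
  then obtain S where S: "(F has_sum S) (Sigma UNIV (\<lambda>_. UNIV))" by (auto simp: summable_on_def)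
  have "((\<lambda>d. f d * suminf g) has_sum S) UNIV"
    by (rule has_sum_Sigma'[OF S]) (auto simp: F_def intro!: has_sum_cmult_right gs)
  moreover have "((\<lambda>d. f d * suminf g) has_sum (suminf f * suminf g)) UNIV"
    by (intro has_sum_cmult_left fs)
  ultimately have "S = suminf f * suminf g" by (rule has_sum_unique)
  with S have "(F has_sum (suminf f * suminf g)) UNIV" by simp
  also have "?this \<longleftrightarrow> (F has_sum (suminf f * suminf g)) ({0<..} \<times> {0<..})"
    by (rule has_sum_cong_neutral) (use f0 g0 in \<open>auto simp: F_def intro!: Nat.gr0I\<close>)
  also have "\<dots> \<longleftrightarrow> ((\<lambda>(n, d). f d * g (n div d)) has_sum (suminf f * suminf g)) (Sigma {0<..} (\<lambda>n. {d. d dvd n}))"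
    by (rule has_sum_reindex_bij_witness[of _ "\<lambda>(n, d). (d, n div d)" "\<lambda>(d, m). (d * m, d)"])
       (auto simp: F_def intro: Nat.gr0I)
  finally have "((\<lambda>n. \<Sum>d | d dvd n. f d * g (n div d)) has_sum (suminf f * suminf g)) {0<..}"
    by (rule has_sum_Sigma') (auto intro!: has_sum_finite)
  also have "?this \<longleftrightarrow> ((\<lambda>n. \<Sum>d | d dvd n. f d * g (n div d)) has_sum (suminf f * suminf g)) UNIV"
    by (rule has_sum_cong_neutral) auto
  finally show ?thesis by (rule has_sum_imp_sums)
qed

lemma ln_of_nat_nonneg: "ln (real n) \<ge> 0"
  by (cases "n = 0") auto

lemma summable_norm_ln_powr:
  assumes "Re s > 1" "\<And>n. norm (a n) \<le> ln (real n)"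
  shows "summable (\<lambda>n. norm (a n * of_nat n powr (-s) :: complex))"
proof (rule summable_comparison_test')
  show "summable (\<lambda>n. ln (real n) * real n powr (- Re s))" using assms by (intro summable_ln_powr) auto
  show "norm (norm (a n * of_nat n powr (-s))) \<le> ln (real n) * real n powr (- Re s)" if "n \<ge> 0" for n
    using assms(2)[of n] by (auto simp: norm_mult norm_of_nat_powr intro!: mult_right_mono)
qed

text \<open>The divisor sum of \<open>mangoldt\<close> is \<open>ln\<close>, and n powr (-s) is
  multiplicative along n = d m.\<close>

lemma mangoldt_dirichlet_series:
  assumes s: "Re s > 1"
  shows "(\<Sum>n. mangoldt n * of_nat n powr (-s)) * (\<Sum>n. of_nat n powr (-s)) =
         (\<Sum>n. of_real (ln (real n)) * of_nat n powr (-s) :: complex)"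
proof -
  have mle: "norm (mangoldt n :: complex) \<le> ln (real n)" for n
    by (cases "n = 0") (auto intro: mangoldt_le)
  have "(\<lambda>n. \<Sum>d | d dvd n. (mangoldt d * of_nat d powr (-s)) * of_nat (n div d) powr (-s)) sums
      ((\<Sum>n. mangoldt n * of_nat n powr (-s)) * (\<Sum>n. of_nat n powr (-s) :: complex))"
  proof (rule dirichlet_product_sums)
    show "summable (\<lambda>n. norm (mangoldt n * of_nat n powr (-s) :: complex))"
      by (intro summable_norm_ln_powr s mle)
    show "summable (\<lambda>n. norm (of_nat n powr (-s) :: complex))"
      using s by (simp add: norm_of_nat_powr summable_real_powr_iff)
  qed auto
  also have "(\<lambda>n. \<Sum>d | d dvd n. (mangoldt d * of_nat d powr (-s)) * of_nat (n div d) powr (-s)) =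
             (\<lambda>n. of_real (ln (real n)) * of_nat n powr (-s))"
  proof
    fix n :: nat
    show "(\<Sum>d | d dvd n. (mangoldt d * of_nat d powr (-s)) * of_nat (n div d) powr (-s)) =
             of_real (ln (real n)) * (of_nat n powr (-s) :: complex)"
    proof (cases "n = 0")
      case False
      have "(\<Sum>d | d dvd n. (mangoldt d * of_nat d powr (-s)) * of_nat (n div d) powr (-s)) =
            (\<Sum>d | d dvd n. mangoldt d * of_nat n powr (-s) :: complex)"
      proof (intro sum.cong refl)
        fix d assume "d \<in> {d. d dvd n}"
        then obtain m where m: "n = d * m" by auto
        hence "d > 0" "m > 0" using False by auto
        hence "(of_nat n :: complex) powr (-s) = of_nat d powr (-s) * of_nat m powr (-s)"
          using powr_times_real[of "of_nat d :: complex" "of_nat m" "-s"] by (simp add: m)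
        thus "(mangoldt d * of_nat d powr (-s)) * of_nat (n div d) powr (-s) = mangoldt d * (of_nat n powr (-s) :: complex)"
          using \<open>d > 0\<close> m by simp
      qed
      also have "\<dots> = of_real (ln (real n)) * of_nat n powr (-s)"
        using mangoldt_sum[OF False, where 'a = complex] by (simp flip: sum_distrib_right)
      finally show ?thesis .
    qed auto
  qed
  finally show ?thesis by (simp add: sums_iff)
qed

text \<open>The left side is -zeta'/zeta, and taking the logarithmic derivative of zeta(s) = psi(s)
  / (s - 1) separates the pole. Nonvanishing of \<open>psi s\<close> also gives
  \<open>s \<noteq> 1\<close> and zeta(s) \<noteq> 0.\<close>

lemma mangoldt_series_eq_psi:
  assumes s: "Re s > 1" and nz: "psi s \<noteq> 0"
  shows "(\<Sum>n. mangoldt n * of_nat n powr (-s)) = 1 / (s - 1) - deriv psi s / psi s"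
proof -
  define Z where "Z = (\<lambda>s. \<Sum>n. (of_nat n :: complex) powr (-s))"
  define A where "A = (\<Sum>n. of_real (ln (real n)) * (of_nat n :: complex) powr (-s))"
  define L where "L = (\<Sum>n. mangoldt n * (of_nat n :: complex) powr (-s))"
  have S: "open {s. Re s > 1}" by (rule open_halfspace_Re_gt)
  have psi: "psi z = (z - 1) * Z z" if "Re z > 1" for z
    unfolding Z_def by (rule psi_eq_zeta) fact
  have "(Z has_field_derivative -A) (at s)"
    unfolding Z_def A_def using dirichlet_has_field_derivative(3)[of "\<lambda>_. 1" s] s by simp
  hence "((\<lambda>z. (z - 1) * Z z) has_field_derivative Z s - (s - 1) * A) (at s)"
    by (auto intro!: derivative_eq_intros)
  hence "(psi has_field_derivative Z s - (s - 1) * A) (at s)"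
    by (rule has_field_derivative_transform_within_open[OF _ S]) (use s psi in auto)
  hence D: "deriv psi s = Z s - (s - 1) * A" by (rule DERIV_imp_deriv)
  have "L * Z s = A" unfolding L_def Z_def A_def by (rule mangoldt_dirichlet_series) fact
  moreover have "Z s \<noteq> 0" "s \<noteq> 1" using psi[OF s] nz by auto
  ultimately have "L = A / Z s" "Z s / ((s - 1) * Z s) = 1 / (s - 1)" "(s - 1) * A / ((s - 1) * Z s) = A / Z s"
    by (simp_all add: field_simps)
  hence "L = 1 / (s - 1) - deriv psi s / psi s"
    unfolding D psi[OF s] diff_divide_distrib by simp
  thus ?thesis by (simp add: L_def)
qed

text \<open>Only prime powers with exponent at least 2 contribute. For fixed p they form a geometric
  series of size at most 2 ln p / p^2, which is summable over p.\<close>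

lemma summable_mangoldt_nonprime:
  "summable (\<lambda>n. if prime n then 0 else mangoldt n / real n)"
proof -
  \<comment> \<open>The pair (p, k) stands for the prime power with exponent k + 2.\<close>
  define F where "F = (\<lambda>(p, k). ln (real p) / real p ^ Suc (Suc k))"
  have "F summable_on Sigma (Collect prime) (\<lambda>_. UNIV)"
  proof (rule summable_on_SigmaI)
    fix p :: nat assume "p \<in> Collect prime"
    hence p: "p \<ge> 2" by (auto dest: prime_ge_2_nat)
    have "(\<lambda>k. ln (real p) / real p ^ 2 * (1 / real p) ^ k) sums (ln (real p) / real p ^ 2 * (1 / (1 - 1 / real p)))"
      using p by (intro sums_mult geometric_sums) auto
    hence "((\<lambda>k. ln (real p) / real p ^ 2 * (1 / real p) ^ k) has_sum (ln (real p) / real p ^ 2 * (1 / (1 - 1 / real p)))) UNIV"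
      using p by (intro sums_nonneg_imp_has_sum) auto
    also have "(\<lambda>k. ln (real p) / real p ^ 2 * (1 / real p) ^ k) = (\<lambda>k. F (p, k))"
      by (auto simp: F_def power2_eq_square power_one_over field_simps)
    finally show "((\<lambda>k. F (p, k)) has_sum (ln (real p) / real p ^ 2 * (1 / (1 - 1 / real p)))) UNIV" .
  next
    have "summable (\<lambda>n. norm (2 * (ln (real n) * real n powr (-2))))"
      unfolding norm_mult by (intro summable_mult) (use summable_ln_powr[of "-2"] in \<open>auto simp: ln_of_nat_nonneg\<close>)
    hence "(\<lambda>n. 2 * (ln (real n) * real n powr (-2))) summable_on UNIV"
      by (rule norm_summable_imp_summable_on)
    hence "(\<lambda>n. 2 * (ln (real n) * real n powr (-2))) summable_on Collect prime"
      by (rule summable_on_subset_banach) auto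
    thus "(\<lambda>p. ln (real p) / real p ^ 2 * (1 / (1 - 1 / real p))) summable_on Collect prime"
    proof (rule summable_on_comparison_test)
      fix p :: nat assume "p \<in> Collect prime"
      hence p: "p \<ge> 2" by (auto dest: prime_ge_2_nat)
      have "1 / (1 - 1 / real p) \<le> 2" using p by (auto simp: field_simps)
      hence "ln (real p) / real p ^ 2 * (1 / (1 - 1 / real p)) \<le> ln (real p) / real p ^ 2 * 2"
        using p by (intro mult_left_mono) auto
      also have "real p powr (-2) = 1 / real p ^ 2" using p by (simp add: powr_minus field_simps)
      hence "ln (real p) / real p ^ 2 * 2 = 2 * (ln (real p) * real p powr (-2))" by simp
      finally show "ln (real p) / real p ^ 2 * (1 / (1 - 1 / real p)) \<le> 2 * (ln (real p) * real p powr (-2))" .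
      show "0 \<le> ln (real p) / real p ^ 2 * (1 / (1 - 1 / real p))" using p by auto
    qed
  next
    fix p k assume "p \<in> Collect (prime :: nat \<Rightarrow> bool)" "k \<in> (UNIV :: nat set)"
    thus "0 \<le> F (p, k)" by (auto simp: F_def dest: prime_ge_1_nat)
  qed
  also have "?this \<longleftrightarrow> (\<lambda>n. mangoldt n / real n) summable_on {n. primepow n \<and> \<not>prime n}"
  proof (rule summable_on_reindex_bij_witness[of _ "\<lambda>n. (aprimedivisor n, multiplicity (aprimedivisor n) n - 2)" "\<lambda>(p,k). p ^ Suc (Suc k)"])
    fix b :: nat assume "b \<in> {n. primepow n \<and> \<not>prime n}"
    hence b: "primepow b" "\<not>prime b" by auto
    then obtain p k where pk: "prime p" "k > 0" "b = p ^ k" by (auto simp: primepow_def)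
    have "k \<noteq> 1" using b pk by auto
    define j where "j = k - 2"
    have j: "k = Suc (Suc j)" using pk(2) \<open>k \<noteq> 1\<close> by (simp add: j_def)
    have "aprimedivisor b = p" using pk by (simp add: aprimedivisor_prime_power)
    moreover have "multiplicity p b = k" using pk by simp
    ultimately have *: "(aprimedivisor b, multiplicity (aprimedivisor b) b - 2) = (p, j)" using j by simp
    show "(case (aprimedivisor b, multiplicity (aprimedivisor b) b - 2) of (p,k) \<Rightarrow> p ^ Suc (Suc k)) = b"
      unfolding * using pk j by simp
    show "(aprimedivisor b, multiplicity (aprimedivisor b) b - 2) \<in> Collect prime \<times> UNIV"
      unfolding * using pk by simp
  next
    fix a :: "nat \<times> nat" assume "a \<in> Collect prime \<times> UNIV"
    then obtain p k where a: "a = (p, k)" "prime p" by auto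
    have ap: "aprimedivisor (p ^ Suc (Suc k)) = p" using a by (intro aprimedivisor_prime_power) auto
    have "multiplicity p (p ^ Suc (Suc k)) = Suc (Suc k)" using a by (intro multiplicity_same_power) auto
    thus "(aprimedivisor (case a of (p,k) \<Rightarrow> p ^ Suc (Suc k)), multiplicity (aprimedivisor (case a of (p,k) \<Rightarrow> p ^ Suc (Suc k))) (case a of (p,k) \<Rightarrow> p ^ Suc (Suc k)) - 2) = a"
      using ap unfolding a prod.case by simp
    have "\<not>prime (p ^ Suc (Suc k))" by (simp only: prime_power_iff) simp
    moreover have "primepow (p ^ Suc (Suc k))" unfolding primepow_def using a(2) by blast
    ultimately show "(case a of (p,k) \<Rightarrow> p ^ Suc (Suc k)) \<in> {n. primepow n \<and> \<not>prime n}"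
      by (simp only: a prod.case mem_Collect_eq) simp
    show "mangoldt (case a of (p,k) \<Rightarrow> p ^ Suc (Suc k)) / real (case a of (p,k) \<Rightarrow> p ^ Suc (Suc k)) = F a"
      unfolding a prod.case F_def using a(2) by (subst mangoldt_primepow') auto
  qed
  also have "\<dots> \<longleftrightarrow> (\<lambda>n. if prime n then 0 else mangoldt n / real n) summable_on UNIV"
    by (rule summable_on_cong_neutral) (auto simp: mangoldt_def)
  finally show ?thesis by (rule summable_on_imp_summable)
qed

definition prime_S0 :: "complex \<Rightarrow> complex" where
  "prime_S0 s = (\<Sum>n. of_bool (prime n) * of_nat n powr (-s))"

definition prime_S1 :: "complex \<Rightarrow> complex" where
  "prime_S1 s = (\<Sum>n. of_bool (prime n) * of_real (ln (real n)) * of_nat n powr (-s))"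

text \<open>For Re s > 1 a proper prime power n contributes at most \<open>mangoldt n / n\<close>,
  whatever s is. Hence the primes alone carry the singular behaviour of -zeta'/zeta on the line Re s
  = 1.\<close>

lemma prime_S1_mangoldt:
  obtains C where "\<And>s. Re s > 1 \<Longrightarrow> norm ((\<Sum>n. mangoldt n * of_nat n powr (-s)) - prime_S1 s) \<le> C"
proof -
  define b where "b = (\<lambda>n. if prime n then 0 else mangoldt n / real n)"
  have b: "summable b" unfolding b_def by (rule summable_mangoldt_nonprime)
  have "norm ((\<Sum>n. mangoldt n * of_nat n powr (-s)) - prime_S1 s) \<le> suminf b" if s: "Re s > 1" for s
  proof -
    have mle: "norm (mangoldt n :: complex) \<le> ln (real n)" for n
      by (cases "n = 0") (auto intro: mangoldt_le)
    have 1: "summable (\<lambda>n. mangoldt n * of_nat n powr (-s) :: complex)"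
      by (rule summable_norm_cancel, intro summable_norm_ln_powr s mle)
    have 2: "summable (\<lambda>n. of_bool (prime n) * of_real (ln (real n)) * of_nat n powr (-s) :: complex)"
      by (rule summable_norm_cancel, intro summable_norm_ln_powr s) (auto simp: ln_of_nat_nonneg)
    have "(\<Sum>n. mangoldt n * of_nat n powr (-s)) - prime_S1 s =
          (\<Sum>n. mangoldt n * of_nat n powr (-s) - of_bool (prime n) * of_real (ln (real n)) * of_nat n powr (-s))"
      unfolding prime_S1_def by (rule suminf_diff[OF 1 2])
    also have "norm \<dots> \<le> suminf b"
    proof (rule norm_suminf_le[OF _ b])
      fix n :: nat
      have "norm (mangoldt n * of_nat n powr (-s) :: complex) \<le> mangoldt n / real n" if n: "n > 0"
      proof -
        have "real n powr (- Re s) \<le> real n powr (-1)" using s n by (intro powr_mono) auto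
        hence "mangoldt n * real n powr (- Re s) \<le> mangoldt n * (1 / real n)"
          using n by (intro mult_left_mono mangoldt_nonneg) (auto simp: powr_minus field_simps)
        thus ?thesis by (simp add: norm_mult norm_of_nat_powr)
      qed
      thus "norm (mangoldt n * of_nat n powr (-s) - of_bool (prime n) * of_real (ln (real n)) * of_nat n powr (-s) :: complex) \<le> b n"
        by (cases "n = 0") (auto simp: b_def)
    qed
    finally show ?thesis .
  qed
  thus ?thesis using that by blast
qed

text \<open>Both the value at \<open>y = 0\<close> (the pole of \<open>\<zeta>\<close>) and at \<open>y \<noteq> 0\<close> (a possible zero of order \<open>m\<close>) are
  covered, so that \<open>\<zeta>(1 + iy) \<noteq> 0\<close> need not be known.\<close>

lemma prime_S1_asymp:
  fixes y :: real
  obtains m C d :: real where "d > 0" "y = 0 \<Longrightarrow> m = -1"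
    "\<And>\<sigma>. \<sigma> \<in> {0<..<d} \<Longrightarrow> norm (prime_S1 (1 + Complex \<sigma> y) + of_real (m / \<sigma>)) \<le> C"
proof -
  define z0 where "z0 = Complex 1 y"
  have "connected {s. 0 < Re s}" by (intro convex_connected convex_halfspace_Re_gt)
  from logderiv_dichotomy[OF psi_holomorphic open_halfspace_Re_gt this, of z0 1]
  obtain k g r where kgr: "r > 0 \<and> continuous_on (cball z0 r) g \<and>
      (\<forall>z\<in>cball z0 r - {z0}. psi z \<noteq> 0 \<and> deriv psi z / psi z = of_nat k / (z - z0) + g z) \<and>
      (psi z0 \<noteq> 0 \<longrightarrow> k = 0)"
    by (force simp: psi_1 z0_def)
  hence r: "r > 0" "continuous_on (cball z0 r) g"
    "\<And>z. z \<in> cball z0 r - {z0} \<Longrightarrow> psi z \<noteq> 0 \<and> deriv psi z / psi z = of_nat k / (z - z0) + g z"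
    "psi z0 \<noteq> 0 \<Longrightarrow> k = 0"
    by blast+
  have "compact (g ` cball z0 r)" by (intro compact_continuous_image r) auto
  then obtain G where G: "\<And>z. z \<in> cball z0 r \<Longrightarrow> norm (g z) \<le> G"
    by (meson bounded_iff compact_imp_bounded imageI)
  obtain C where C: "\<And>s. Re s > 1 \<Longrightarrow> norm ((\<Sum>n. mangoldt n * of_nat n powr (-s)) - prime_S1 s) \<le> C"
    using prime_S1_mangoldt by blast
  \<comment> \<open>For y = 0 one has psi 1 = 1, so k = 0 and only the pole 1/(s - 1) = 1/sigma is
    left. For y \<noteq> 0 that pole is bounded, and a zero of order k contributes -k/sigma.\<close>
  define m where "m = (if y = 0 then -1 else real k)"
  \<comment> \<open>The summand \<open>1 / \<bar>y\<bar>\<close> bounds 1/(s - 1) off the real axis;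
    for y = 0 it is 0 by the convention on division.\<close>
  have "norm (prime_S1 (1 + Complex \<sigma> y) + of_real (m / \<sigma>)) \<le> C + G + 1 / \<bar>y\<bar>"
    if \<sigma>: "\<sigma> \<in> {0<..<r}" for \<sigma>
  proof -
    define s where "s = 1 + Complex \<sigma> y"
    have s: "Re s > 1" using \<sigma> by (simp add: s_def)
    have sz: "s - z0 = of_real \<sigma>" by (simp add: s_def z0_def complex_eq_iff)
    have sb: "s \<in> cball z0 r - {z0}" using \<sigma> sz by (auto simp: dist_norm norm_minus_commute)
    define L where "L = (\<Sum>n. mangoldt n * of_nat n powr (-s) :: complex)"
    have "L = 1 / (s - 1) - deriv psi s / psi s"
      unfolding L_def using s r(3)[OF sb] by (intro mangoldt_series_eq_psi) auto
    also have "\<dots> = 1 / (s - 1) - of_nat k / of_real \<sigma> - g s"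
      using r(3)[OF sb] by (simp add: sz)
    finally have L: "L = 1 / (s - 1) - of_nat k / of_real \<sigma> - g s" .
    have "norm (L + of_real (m / \<sigma>)) \<le> G + 1 / \<bar>y\<bar>"
    proof (cases "y = 0")
      case True
      have "k = 0" using r(4) True psi_1 by (auto simp: z0_def complex_eq_iff one_complex.code)
      moreover have "s - 1 = of_real \<sigma>" using True by (simp add: s_def complex_eq_iff)
      ultimately have "L + of_real (m / \<sigma>) = - g s" using True by (simp add: L m_def)
      thus ?thesis using G[of s] sb True by simp
    next
      case False
      have "\<bar>y\<bar> \<le> norm (s - 1)" using abs_Im_le_cmod[of "s - 1"] by (simp add: s_def)
      hence "norm (1 / (s - 1)) \<le> 1 / \<bar>y\<bar>" using False by (auto simp: norm_divide intro!: divide_left_mono mult_pos_pos)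
      moreover have "L + of_real (m / \<sigma>) = 1 / (s - 1) - g s" using False by (simp add: L m_def)
      moreover have "norm (1 / (s - 1) - g s) \<le> norm (1 / (s - 1)) + norm (g s)" by (rule norm_triangle_ineq4)
      ultimately show ?thesis using G[of s] sb by simp
    qed
    moreover have "norm (L - prime_S1 s) \<le> C" unfolding L_def by (rule C) fact
    moreover have "norm (prime_S1 s + of_real (m / \<sigma>)) \<le> norm (L + of_real (m / \<sigma>)) + norm (L - prime_S1 s)"
      using norm_triangle_ineq4[of "L + of_real (m / \<sigma>)" "L - prime_S1 s"] by (simp add: add.commute)
    ultimately show ?thesis by (simp add: s_def)
  qed
  thus ?thesis using that[of r m] r(1) by (auto simp: m_def)
qed

lemma prime_S0_has_field_derivative:
  assumes "Re s > 1"
  shows "(prime_S0 has_field_derivative - prime_S1 s) (at s)"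
  using dirichlet_has_field_derivative(3)[of "\<lambda>n. of_bool (prime n)" s] assms
  by (simp add: prime_S0_def[abs_def] prime_S1_def)

text \<open>Integrates the asymptotics of \<open>prime_S1\<close> along a horizontal segment.
  Subtracting m Ln w from \<open>prime_S0\<close> leaves a function with derivative bounded by C,
  hence a bounded function on the segment. Both statements share the same m.\<close>

lemma prime_S0_S1_asymp:
  fixes y :: real
  obtains m C d :: real where "d > 0" "y = 0 \<Longrightarrow> m = -1"
    "\<And>\<sigma>. \<sigma> \<in> {0<..<d} \<Longrightarrow> norm (prime_S1 (1 + Complex \<sigma> y) + of_real (m / \<sigma>)) \<le> C"
    "\<And>\<sigma>. \<sigma> \<in> {0<..<d} \<Longrightarrow> norm (prime_S0 (1 + Complex \<sigma> y) - of_real (m * ln \<sigma>)) \<le> C"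
proof -
  obtain m C d :: real where d: "d > 0" and m: "y = 0 \<Longrightarrow> m = -1" and
    C: "\<And>\<sigma>. \<sigma> \<in> {0<..<d} \<Longrightarrow> norm (prime_S1 (1 + Complex \<sigma> y) + of_real (m / \<sigma>)) \<le> C"
    by (rule prime_S1_asymp[of y]) (rule that)
  define f where "f = (\<lambda>w. prime_S0 (1 + Complex 0 y + w) - of_real m * Ln w)"
  define f' where "f' = (\<lambda>w. - prime_S1 (1 + Complex 0 y + w) - of_real m / w)"
  define u where "u = d / 2"
  have u: "u \<in> {0<..<d}" using d by (simp add: u_def)
  have Cxy: "Complex 0 y + of_real t = Complex t y" for t by (simp add: complex_eq_iff)
  have "norm (f (of_real \<sigma>) - f (of_real u)) \<le> C * d" if \<sigma>: "\<sigma> \<in> {0<..<d}" for \<sigma>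
  proof -
    define S :: "complex set" where "S = closed_segment (of_real \<sigma>) (of_real u)"
    have S: "\<exists>t. t \<in> {0<..<d} \<and> w = of_real t" if "w \<in> S" for w
    proof -
      have "w \<in> of_real ` closed_segment \<sigma> u" using that by (simp add: S_def closed_segment_of_real)
      moreover have "closed_segment \<sigma> u \<subseteq> {0<..<d}" using \<sigma> u by (intro closed_segment_subset) auto
      ultimately show ?thesis by auto
    qed
    have "norm (f (of_real \<sigma>) - f (of_real u)) \<le> C * norm (of_real \<sigma> - of_real u :: complex)"
    proof (rule field_differentiable_bound[where S = S and f' = f'])
      show "convex S" "of_real \<sigma> \<in> S" "of_real u \<in> S" by (auto simp: S_def)
      fix w assume "w \<in> S"
      then obtain t where t: "t \<in> {0<..<d}" "w = of_real t" using S by blast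
      have Re: "Re (1 + Complex 0 y + w) > 1" using t by simp
      have nz: "w \<notin> \<real>\<^sub>\<le>\<^sub>0" using t by (auto simp: complex_nonpos_Reals_iff)
      hence nz': "w \<noteq> 0" by auto
      have D1: "((\<lambda>w. prime_S0 (1 + Complex 0 y + w)) has_field_derivative - prime_S1 (1 + Complex 0 y + w) * 1) (at w)"
        by (rule DERIV_chain2[where g = "\<lambda>w. 1 + Complex 0 y + w" and x = w, OF prime_S0_has_field_derivative[OF Re]]) (auto intro!: derivative_eq_intros)
      have D2: "((\<lambda>w. of_real m * Ln w) has_field_derivative of_real m / w) (at w)"
        using nz nz' by (auto intro!: derivative_eq_intros simp: field_simps)
      have "(f has_field_derivative f' w) (at w)"
        using DERIV_diff[OF D1 D2] unfolding f_def f'_def by simp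
      thus "(f has_field_derivative f' w) (at w within S)" by (rule has_field_derivative_at_within)
      have "f' w = - (prime_S1 (1 + Complex t y) + of_real (m / t))"
        by (simp add: f'_def t add.assoc Cxy)
      thus "norm (f' w) \<le> C" using C[OF t(1)] by (simp only: norm_minus_cancel)
    qed
    also have "norm (of_real \<sigma> - of_real u :: complex) = \<bar>\<sigma> - u\<bar>" by (simp flip: of_real_diff)
    also have "C * \<bar>\<sigma> - u\<bar> \<le> C * d"
    proof (intro mult_left_mono)
      show "C \<ge> 0" using C[OF u] by (meson norm_ge_zero order_trans)
    qed (use \<sigma> u in auto)
    finally show ?thesis .
  qed
  hence *: "norm (f (of_real \<sigma>)) \<le> C * d + norm (f (of_real u))" if "\<sigma> \<in> {0<..<d}" for \<sigma>
    using that norm_triangle_sub[of "f (of_real \<sigma>)" "f (of_real u)"] by fastforce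
  have **: "f (of_real \<sigma>) = prime_S0 (1 + Complex \<sigma> y) - of_real (m * ln \<sigma>)" if "\<sigma> \<in> {0<..<d}" for \<sigma>
    using that by (simp add: f_def add.assoc Cxy Ln_of_real)
  show ?thesis
  proof (rule that[of d m "max C (C * d + norm (f (of_real u)))"])
    fix \<sigma> assume \<sigma>: "\<sigma> \<in> {0<..<d}"
    show "norm (prime_S1 (1 + Complex \<sigma> y) + of_real (m / \<sigma>)) \<le> max C (C * d + norm (f (of_real u)))"
      using C[OF \<sigma>] by (rule max.coboundedI1)
    show "norm (prime_S0 (1 + Complex \<sigma> y) - of_real (m * ln \<sigma>)) \<le> max C (C * d + norm (f (of_real u)))"
      using *[OF \<sigma>] unfolding **[OF \<sigma>] by (rule max.coboundedI2)
  qed (use d m in auto)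
qed

section \<open>Abel summation against the prime counting function\<close>

text \<open>An antiderivative of \<open>- ln x \<cdot> x powr (-z-1)\<close>.\<close>

definition step_prim :: "complex \<Rightarrow> real \<Rightarrow> complex" where
  "step_prim z x = of_real x powr (-z) * (of_real (ln x) / z + 1 / z ^ 2)"

lemma step_prim_derivs:
  fixes w z :: complex
  assumes "w \<notin> \<real>\<^sub>\<le>\<^sub>0" "z \<noteq> 0"
  shows "((\<lambda>w. w powr (-z) * (Ln w / z + 1 / z ^ 2)) has_field_derivative - (Ln w * w powr (-z-1))) (at w)"
    and "((\<lambda>w. - (Ln w * w powr (-z-1))) has_field_derivative ((z + 1) * Ln w - 1) * w powr (-z-2)) (at w)"
proof -
  have w: "w \<noteq> 0" using assms by auto
  have 1: "w powr (-z-1) = w powr (-z) / w" using w by (simp add: powr_diff)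
  have 3: "w powr (-z-1-1) = w powr (-z) / (w * w)"
    unfolding powr_diff[of w "-z-1" 1] 1 using w by simp
  have eq: "-z-2 = -z-1-1" by simp
  have 2: "w powr (-z-2) = w powr (-z) / (w * w)"
    unfolding eq by (rule 3)
  show "((\<lambda>w. w powr (-z) * (Ln w / z + 1 / z ^ 2)) has_field_derivative - (Ln w * w powr (-z-1))) (at w)"
    using assms w unfolding 1
    by (auto intro!: derivative_eq_intros simp: 1 field_simps power2_eq_square)
  have "((\<lambda>w. - (Ln w * w powr (-z-1))) has_field_derivative
          - (inverse w * w powr (-z-1) + (-z-1) * w powr (-z-1-1) * Ln w)) (at w)"
    by (intro DERIV_minus DERIV_mult has_field_derivative_Ln has_field_derivative_powr assms)
  thus "((\<lambda>w. - (Ln w * w powr (-z-1))) has_field_derivative ((z + 1) * Ln w - 1) * w powr (-z-2)) (at w)"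
    by (rule DERIV_cong) (unfold 1 2 3, use w in \<open>simp add: field_simps\<close>)
qed

text \<open>Turns each weight ln n * n powr (-z - 1) into a difference of \<open>step_prim\<close>,
  so that partial summation applies. By the Taylor bound the error is of the order of the next power
  of n.\<close>

lemma step_prim_unit_step:
  assumes z: "z \<noteq> 0" "Re z \<ge> 0" and n: "n \<ge> 1"
  shows "norm (step_prim z (real n) - step_prim z (real (Suc n)) - of_real (ln (real n)) * of_nat n powr (-z-1))
           \<le> (1 + (1 + norm z) * ln (real n + 1)) * real n powr (- Re z - 2)"
proof -
  define x where "x = real n"
  have x: "x \<ge> 1" using n by (simp add: x_def)
  define f where "f = (\<lambda>w. w powr (-z) * (Ln w / z + 1 / z ^ 2))"
  have f: "f (of_real t) = step_prim z t" if "t > 0" for t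
    using that by (simp add: f_def step_prim_def Ln_of_real)
  have "norm (f (of_real (x + 1)) - f (of_real x) - - (Ln (of_real x) * of_real x powr (-z-1)))
          \<le> (1 + (1 + norm z) * ln (x + 1)) * x powr (- Re z - 2)"
  proof (rule taylor_unit_step[where f = f and f' = "\<lambda>w. - (Ln w * w powr (-z-1))"
        and f'' = "\<lambda>w. ((z + 1) * Ln w - 1) * w powr (-z-2)"])
    fix t assume t: "t \<in> {x..x+1}"
    have t0: "t \<ge> 1" using t x by auto
    hence nz: "complex_of_real t \<notin> \<real>\<^sub>\<le>\<^sub>0" by (simp add: complex_nonpos_Reals_iff)
    show "(f has_field_derivative - (Ln (of_real t) * of_real t powr (-z-1))) (at (of_real t))"
      unfolding f_def by (rule step_prim_derivs[OF nz z(1)])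
    show "((\<lambda>w. - (Ln w * w powr (-z-1))) has_field_derivative
             ((z + 1) * Ln (of_real t) - 1) * of_real t powr (-z-2)) (at (of_real t))"
      by (rule step_prim_derivs[OF nz z(1)])
    have "norm ((z + 1) * Ln (of_real t) - 1) \<le> norm (z + 1) * \<bar>ln t\<bar> + 1"
      using norm_triangle_ineq4[of "(z + 1) * Ln (of_real t)" 1] t0 by (simp add: norm_mult Ln_of_real)
    also have "\<dots> \<le> (1 + norm z) * ln (x + 1) + 1"
      using t t0 norm_triangle_ineq[of z 1] by (intro add_mono mult_mono) auto
    finally have "norm ((z + 1) * Ln (of_real t) - 1) \<le> 1 + (1 + norm z) * ln (x + 1)" by simp
    moreover have "t powr (- Re z - 2) \<le> x powr (- Re z - 2)"
      using t x z by (intro powr_mono2') auto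
    ultimately show "norm (((z + 1) * Ln (of_real t) - 1) * of_real t powr (-z-2))
                       \<le> (1 + (1 + norm z) * ln (x + 1)) * x powr (- Re z - 2)"
      using t0 x unfolding norm_mult by (intro mult_mono) (auto simp: norm_of_real_powr)
  qed
  also have "f (of_real (x + 1)) - f (of_real x) - - (Ln (of_real x) * of_real x powr (-z-1)) =
      - (step_prim z (real n) - step_prim z (real (Suc n)) - of_real (ln (real n)) * of_nat n powr (-z-1))"
    using x f[of x] f[of "x + 1"] by (simp add: x_def Ln_of_real add.commute del: of_real_add)
  finally show ?thesis by (simp only: norm_minus_cancel x_def)
qed

text \<open>Controls the rounding of block ends to integers. The bound is free of z, although
  \<open>step_prim\<close> itself blows up as z tends to 0, because its derivative does not contain
  1/z.\<close>

lemma step_prim_diff: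
  assumes z: "z \<noteq> 0" "Re z \<ge> 0" and x: "1 \<le> x" "x \<le> y" "y \<le> x + 1"
  shows "norm (step_prim z y - step_prim z x) \<le> (1 + ln x) / x"
proof -
  define f where "f = (\<lambda>w. w powr (-z) * (Ln w / z + 1 / z ^ 2))"
  have f: "f (of_real t) = step_prim z t" if "t > 0" for t
    using that by (simp add: f_def step_prim_def Ln_of_real)
  define S :: "complex set" where "S = closed_segment (of_real y) (of_real x)"
  have S: "\<exists>t. t \<in> {x..y} \<and> w = of_real t" if "w \<in> S" for w
    using that x unfolding S_def closed_segment_of_real by (auto simp: closed_segment_eq_real_ivl split: if_splits)
  have "norm (f (of_real y) - f (of_real x)) \<le> ((1 + ln x) / x) * norm (of_real y - of_real x :: complex)"
  proof (rule field_differentiable_bound[where S = S and f' = "\<lambda>w. - (Ln w * w powr (-z-1))"])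
    show "convex S" "of_real y \<in> S" "of_real x \<in> S" by (auto simp: S_def)
    fix w assume "w \<in> S"
    then obtain t where t: "t \<in> {x..y}" "w = of_real t" using S by blast
    have t0: "t \<ge> 1" using t x by auto
    hence nz: "complex_of_real t \<notin> \<real>\<^sub>\<le>\<^sub>0" by (simp add: complex_nonpos_Reals_iff)
    show "(f has_field_derivative - (Ln w * w powr (-z-1))) (at w within S)"
      unfolding f_def t(2) by (rule has_field_derivative_at_within, rule step_prim_derivs[OF nz z(1)])
    have "norm (- (Ln w * w powr (-z-1))) = ln t * t powr (- Re z - 1)"
      using t0 t(2) by (simp add: norm_mult Ln_of_real norm_of_real_powr)
    also have "\<dots> \<le> (1 + ln x) * x powr (-1)"
    proof (intro mult_mono)
      have "t \<le> x * 2" using t x by auto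
      \<comment> \<open>Since 2 \<le> e, doubling x raises the logarithm by at most 1.\<close>
      also have "\<dots> \<le> x * exp 1" using exp_ge_add_one_self[of 1] x by (intro mult_left_mono) auto
      finally have "ln t \<le> ln (x * exp 1)" using t0 by (intro ln_mono) auto
      also have "\<dots> = 1 + ln x" using x by (simp add: ln_mult)
      finally show "ln t \<le> 1 + ln x" .
      have "t powr (- Re z - 1) \<le> t powr (-1)" using t0 z by (intro powr_mono) auto
      also have "\<dots> \<le> x powr (-1)" using t x by (intro powr_mono2') auto
      finally show "t powr (- Re z - 1) \<le> x powr (-1)" .
    qed (use x in auto)
    also have "\<dots> = (1 + ln x) / x" using x by (simp add: powr_minus field_simps)
    finally show "norm (- (Ln w * w powr (-z-1))) \<le> (1 + ln x) / x" .
  qed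
  also have "norm (of_real y - of_real x :: complex) = \<bar>y - x\<bar>" by (simp flip: of_real_diff)
  also have "((1 + ln x) / x) * \<bar>y - x\<bar> \<le> ((1 + ln x) / x) * 1" using x by (intro mult_left_mono) auto
  finally show ?thesis using f x by simp
qed

text \<open>Majorant for the error of \<open>step_prim_unit_step\<close> over all z with norm at
  most c. It contains no real part of z, so its sum survives the limit sigma \<rightarrow> 0. Its
  value at n = 0 is 0, because \<open>0 powr -2 = 0\<close>.\<close>

definition step_err :: "real \<Rightarrow> nat \<Rightarrow> real" where
  "step_err c n = (1 + (1 + c) * ln (real n + 1)) * real n powr (-2)"

lemma step_err_nonneg: "c \<ge> 0 \<Longrightarrow> step_err c n \<ge> 0"
  by (auto simp: step_err_def intro!: mult_nonneg_nonneg add_nonneg_nonneg)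

lemma summable_step_err: "summable (step_err c)"
proof (rule summable_comparison_test_bigo)
  show "summable (\<lambda>n. norm (real n powr (-3/2)))" by (simp add: summable_real_powr_iff)
  have 1: "(\<lambda>n. real n powr (-2)) \<in> O(\<lambda>n. real n powr (-3/2))" by real_asymp
  have 2: "(\<lambda>n. ln (real n + 1) * real n powr (-2)) \<in> O(\<lambda>n. real n powr (-3/2))" by real_asymp
  have "(\<lambda>n. real n powr (-2) + (1 + c) * (ln (real n + 1) * real n powr (-2))) \<in> O(\<lambda>n. real n powr (-3/2))"
    by (intro sum_in_bigo 1 landau_o.big.cmult_in_iff'[THEN iffD2] cmult_in_bigo_iff[THEN iffD2] disjI2 2)
  also have "(\<lambda>n. real n powr (-2) + (1 + c) * (ln (real n + 1) * real n powr (-2))) = step_err c"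
    by (auto simp: step_err_def algebra_simps)
  finally show "step_err c \<in> O(\<lambda>n. real n powr (-3/2))" .
qed

text \<open>The exponent r is the growth of the coefficient: r = 1 for
  \<open>prime_pi n \<le> n\<close>, used at 1 + z, and r = 0 for the bounded reciprocals
  \<open>inv_floor\<close>, used at z.\<close>

lemma norm_powr_le_step_err:
  assumes "Re z \<ge> r" "norm z \<le> c" "n \<ge> 1"
  shows "(1 + (1 + norm z) * ln (real n + 1)) * real n powr (- Re z - 2) * real n powr r \<le> step_err c n"
proof -
  have "real n powr (- Re z - 2) * real n powr r = real n powr (r - Re z - 2)"
    by (subst powr_add [symmetric]) (simp add: algebra_simps)
  also have "\<dots> \<le> real n powr (-2)" using assms by (intro powr_mono) auto
  finally have *: "real n powr (- Re z - 2) * real n powr r \<le> real n powr (-2)" .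
  have "(1 + (1 + norm z) * ln (real n + 1)) * (real n powr (- Re z - 2) * real n powr r) \<le> step_err c n"
    unfolding step_err_def using assms(2) order_trans[OF norm_ge_zero assms(2)]
    by (intro mult_mono * add_mono order_refl) auto
  thus ?thesis by (simp add: mult.assoc)
qed

lemma prime_pi_0: "prime_pi 0 = 0"
proof -
  have "{p :: nat. prime p \<and> p \<le> 0} = {}" by auto
  thus ?thesis by (simp add: prime_pi_def)
qed

lemma prime_pi_Suc: "prime_pi (Suc n) = prime_pi n + of_bool (prime (Suc n))"
proof -
  have "{p. prime p \<and> p \<le> Suc n} = (if prime (Suc n) then insert (Suc n) {p. prime p \<and> p \<le> n} else {p. prime p \<and> p \<le> n})"
    by (auto simp: le_Suc_eq)
  moreover have "finite {p. prime p \<and> p \<le> n}" by (rule finite_subset[of _ "{..n}"]) auto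
  ultimately show ?thesis by (simp add: prime_pi_def)
qed

lemma prime_pi_le: "prime_pi n \<le> n"
  by (induction n) (auto simp: prime_pi_0 prime_pi_Suc)

text \<open>Partial summation moves the difference onto \<open>prime_pi\<close>, whose jumps are the
  prime indicator. The boundary term has index N - 1, the last n that occurs in the sum.\<close>

lemma sum_prime_pi_by_parts:
  fixes W :: "nat \<Rightarrow> complex"
  shows "(\<Sum>n<N. of_nat (prime_pi n) * (W n - W (Suc n))) =
         (\<Sum>n<N. of_bool (prime n) * W n) - of_nat (prime_pi (N - 1)) * W N"
proof (induction N)
  case (Suc N)
  thus ?case by (cases N) (auto simp: prime_pi_0 prime_pi_Suc algebra_simps)
qed (simp add: prime_pi_0)

text \<open>With s = 1 + z, partial summation turns the series into the sum of
  \<open>step_prim s p\<close> over the primes p; the two summands of \<open>step_prim\<close> give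
  the two quotients. The error bound depends only on c, hence is uniform as Re z \<rightarrow>
  0.\<close>

lemma suminf_prime_pi:
  assumes z: "Re z > 0" and c: "norm (1 + z) \<le> c"
  shows "summable (\<lambda>n. of_nat (prime_pi n) * of_real (ln (real n)) * of_nat n powr (-z-2))" (is "summable ?f")
    and "norm ((\<Sum>n. of_nat (prime_pi n) * of_real (ln (real n)) * of_nat n powr (-z-2)) -
           (prime_S1 (1 + z) / (1 + z) + prime_S0 (1 + z) / (1 + z) ^ 2)) \<le> suminf (step_err c)"
proof -
  define s where "s = 1 + z"
  have s: "Re s > 1" "s \<noteq> 0" using z by (auto simp: s_def complex_eq_iff)
  have c0: "c \<ge> 0" using c norm_ge_zero order_trans by blast
  show summ: "summable ?f"
  proof (rule summable_comparison_test')
    show "summable (\<lambda>n. ln (real n) * real n powr (- Re s))" using s by (intro summable_ln_powr) auto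
    fix n :: nat assume "n \<ge> 0"
    have "norm (?f n) = real (prime_pi n) * (ln (real n) * real n powr (- Re z - 2))"
      by (simp add: norm_mult norm_of_nat_powr ln_of_nat_nonneg)
    also have "\<dots> \<le> real n * (ln (real n) * real n powr (- Re z - 2))"
      using prime_pi_le[of n] by (intro mult_right_mono mult_nonneg_nonneg ln_of_nat_nonneg) auto
    also have "\<dots> = ln (real n) * real n powr (- Re s)"
    proof (cases "n = 0")
      case False
      hence "real n * real n powr (- Re z - 2) = real n powr (- Re s)"
        using powr_mult_base[of "real n" "- Re z - 2"] by (simp add: s_def)
      thus ?thesis by (simp add: mult.left_commute)
    qed auto
    finally show "norm (?f n) \<le> ln (real n) * real n powr (- Re s)" .
  qed
  define W where "W = (\<lambda>n. step_prim s (real n))"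
  have err: "norm (of_nat (prime_pi n) * (W n - W (Suc n)) - ?f n) \<le> step_err c n" for n
  proof (cases "n = 0")
    case False
    have "of_nat (prime_pi n) * (W n - W (Suc n)) - ?f n =
          of_nat (prime_pi n) * (W n - W (Suc n) - of_real (ln (real n)) * of_nat n powr (-s-1))"
      by (simp add: s_def algebra_simps)
    hence "norm (of_nat (prime_pi n) * (W n - W (Suc n)) - ?f n) =
          real (prime_pi n) * norm (W n - W (Suc n) - of_real (ln (real n)) * of_nat n powr (-s-1))"
      by (simp only: norm_mult norm_of_nat)
    also have "\<dots> \<le> real n * ((1 + (1 + norm s) * ln (real n + 1)) * real n powr (- Re s - 2))"
      unfolding W_def using False prime_pi_le[of n] s by (intro mult_mono step_prim_unit_step) auto
    also have "\<dots> = (1 + (1 + norm s) * ln (real n + 1)) * real n powr (- Re s - 2) * real n powr 1"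
      by simp
    also have "\<dots> \<le> step_err c n"
      using s c False by (intro norm_powr_le_step_err) (auto simp: s_def)
    finally show ?thesis .
  qed (simp add: prime_pi_0 step_err_def)
  have pp: "(\<lambda>n. of_bool (prime n) * W n) sums (prime_S1 s / s + prime_S0 s / s ^ 2)"
  proof -
    have "(\<lambda>n. (of_bool (prime n) * of_real (ln (real n)) * of_nat n powr (-s)) / s +
             (of_bool (prime n) * of_nat n powr (-s)) / s ^ 2) sums (prime_S1 s / s + prime_S0 s / s ^ 2)"
      unfolding prime_S1_def prime_S0_def
      by (intro sums_add sums_divide dirichlet_has_field_derivative s) auto
    also have "(\<lambda>n. (of_bool (prime n) * of_real (ln (real n)) * of_nat n powr (-s)) / s +
             (of_bool (prime n) * of_nat n powr (-s)) / s ^ 2) = (\<lambda>n. of_bool (prime n) * W n)"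
      by (auto simp: W_def step_prim_def algebra_simps add_divide_distrib fun_eq_iff)
    finally show ?thesis .
  qed
  \<comment> \<open>The trivial bound \<open>prime_pi n \<le> n\<close> suffices here, because Re s
    > 1 leaves a negative power of N.\<close>
  have bd: "(\<lambda>N. of_nat (prime_pi (N - 1)) * W N) \<longlonglongrightarrow> 0"
  proof (rule Lim_null_comparison)
    define b where "b = (\<lambda>N::nat. (ln (real N) * real N powr (1 - Re s)) / norm s + real N powr (1 - Re s) / norm s ^ 2)"
    define e where "e = Re s - 1"
    have e: "e > 0" using s by (simp add: e_def)
    have [simp]: "1 - Re s = - e" by (simp add: e_def)
    have "(\<lambda>N. ln (real N) * real N powr (-e)) \<longlonglongrightarrow> 0" using e by real_asymp
    moreover have "(\<lambda>N. real N powr (-e)) \<longlonglongrightarrow> 0" using e by real_asymp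
    ultimately have "b \<longlonglongrightarrow> 0 / norm s + 0 / norm s ^ 2"
      unfolding b_def using s by (intro tendsto_intros) auto
    thus "b \<longlonglongrightarrow> 0" by simp
    show "\<forall>\<^sub>F N in sequentially. norm (of_nat (prime_pi (N - 1)) * W N) \<le> b N"
    proof (rule eventually_mono[OF eventually_gt_at_top[of 0]])
      fix N :: nat assume N: "N > 0"
      have "norm (W N) \<le> real N powr (- Re s) * (ln (real N) / norm s + 1 / norm s ^ 2)"
        unfolding W_def step_prim_def norm_mult
      proof (intro mult_mono)
        have "norm (of_real (ln (real N)) / s + 1 / s ^ 2) \<le> norm (of_real (ln (real N)) / s) + norm (1 / s ^ 2)"
          by (rule norm_triangle_ineq)
        thus "norm (of_real (ln (real N)) / s + 1 / s ^ 2) \<le> ln (real N) / norm s + 1 / norm s ^ 2"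
          by (simp add: norm_divide norm_power ln_of_nat_nonneg)
      qed (auto simp: norm_of_nat_powr)
      moreover have "real (prime_pi (N - 1)) \<le> real N" using prime_pi_le[of "N - 1"] N by simp
      ultimately have "norm (of_nat (prime_pi (N - 1)) * W N) \<le>
          real N * (real N powr (- Re s) * (ln (real N) / norm s + 1 / norm s ^ 2))"
        unfolding norm_mult by (intro mult_mono) auto
      also have "\<dots> = (real N * real N powr (- Re s)) * (ln (real N) / norm s + 1 / norm s ^ 2)" by simp
      also have "real N * real N powr (- Re s) = real N powr (1 - Re s)"
        using N powr_mult_base[of "real N" "- Re s"] by simp
      finally show "norm (of_nat (prime_pi (N - 1)) * W N) \<le> b N"
        by (simp add: b_def algebra_simps)
    qed
  qed
  have bound: "norm ((\<Sum>n<N. of_bool (prime n) * W n) - of_nat (prime_pi (N - 1)) * W N - (\<Sum>n<N. ?f n))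
                 \<le> suminf (step_err c)" for N
  proof -
    have "norm ((\<Sum>n<N. of_bool (prime n) * W n) - of_nat (prime_pi (N - 1)) * W N - (\<Sum>n<N. ?f n)) =
          norm (\<Sum>n<N. of_nat (prime_pi n) * (W n - W (Suc n)) - ?f n)"
      by (simp only: sum_subtractf sum_prime_pi_by_parts)
    also have "\<dots> \<le> (\<Sum>n<N. step_err c n)" by (intro sum_norm_le err)
    also have "\<dots> \<le> suminf (step_err c)"
      by (intro sum_le_suminf summable_step_err) (auto intro: step_err_nonneg c0)
    finally show ?thesis .
  qed
  have "(\<lambda>N. (\<Sum>n<N. of_bool (prime n) * W n) - of_nat (prime_pi (N - 1)) * W N - (\<Sum>n<N. ?f n))
          \<longlonglongrightarrow> (prime_S1 s / s + prime_S0 s / s ^ 2) - 0 - suminf ?f"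
    by (intro tendsto_diff bd summable_LIMSEQ summ) (use pp in \<open>simp add: sums_def\<close>)
  from Lim_norm_ubound[OF sequentially_bot this always_eventually] bound
  have "norm ((prime_S1 s / s + prime_S0 s / s ^ 2) - 0 - suminf ?f) \<le> suminf (step_err c)" by blast
  thus "norm ((\<Sum>n. of_nat (prime_pi n) * of_real (ln (real n)) * of_nat n powr (-z-2)) -
           (prime_S1 (1 + z) / (1 + z) + prime_S0 (1 + z) / (1 + z) ^ 2)) \<le> suminf (step_err c)"
    by (simp add: s_def norm_minus_commute)
qed

section \<open>The contribution of the floor function\<close>

definition log_floor :: "nat \<Rightarrow> int" where
  "log_floor n = \<lfloor>ln (real n) - 1/2\<rfloor>"

text \<open>Since \<open>x / 0 = 0\<close> and the floor is negative for small \<open>n\<close>, the reciprocal is cut off there.\<close>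

definition inv_floor :: "nat \<Rightarrow> real" where
  "inv_floor n = (if log_floor n \<ge> 1 then 1 / real_of_int (log_floor n) else 0)"

text \<open>The first integer of the range on which \<open>log_floor\<close> has the value \<open>k\<close>.\<close>

definition block :: "nat \<Rightarrow> nat" where
  "block k = nat \<lceil>exp (real k + 1/2)\<rceil>"

lemma inv_floor_bounds: "0 \<le> inv_floor n" "inv_floor n \<le> 1"
  by (auto simp: inv_floor_def)

lemma block_bounds: "exp (real k + 1/2) \<le> real (block k)" "real (block k) \<le> exp (real k + 1/2) + 1"
proof -
  have "real (block k) = real_of_int \<lceil>exp (real k + 1/2)\<rceil>"
    unfolding block_def by (subst of_nat_nat) (auto intro: less_trans[OF _ exp_gt_zero])
  thus "exp (real k + 1/2) \<le> real (block k)" "real (block k) \<le> exp (real k + 1/2) + 1"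
    by linarith+
qed

lemma block_le_iff: "block k \<le> n \<longleftrightarrow> exp (real k + 1/2) \<le> real n"
  unfolding block_def by (simp add: nat_le_iff ceiling_le_iff)

lemma log_floor_ge_iff: "log_floor n \<ge> int k \<longleftrightarrow> block k \<le> n"
proof (cases "n = 0")
  case True
  have "\<not>block k \<le> 0" unfolding block_le_iff by simp
  \<comment> \<open>\<open>ln 0 = 0\<close> by convention, so the floor of -1/2 is taken.\<close>
  moreover have "log_floor 0 = -1" by (simp add: log_floor_def)
  ultimately show ?thesis using True by simp
next
  case False
  have "log_floor n \<ge> int k \<longleftrightarrow> real k + 1/2 \<le> ln (real n)"
    unfolding log_floor_def le_floor_iff by auto
  also have "\<dots> \<longleftrightarrow> exp (real k + 1/2) \<le> real n"
    using False by (simp add: ln_ge_iff)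
  finally show ?thesis by (simp add: block_le_iff)
qed

lemma block_mono: "k \<le> l \<Longrightarrow> block k \<le> block l"
  using block_bounds(1)[of l] by (auto simp: block_le_iff intro: order.trans[rotated])

lemma inv_floor_block:
  assumes "k > 0" "n \<in> {block k..<block (Suc k)}"
  shows "inv_floor n = 1 / real k"
proof -
  have "log_floor n \<ge> int k" "\<not>log_floor n \<ge> int (Suc k)"
    using assms unfolding log_floor_ge_iff by auto
  hence "log_floor n = int k" by simp
  thus ?thesis using assms by (simp add: inv_floor_def)
qed

text \<open>On the block of k the coefficient is the constant 1/k, so the differences of V telescope
  to the block ends; before \<open>block 1\<close> the coefficient is 0.\<close>

lemma sum_inv_floor_blocks:
  fixes V :: "nat \<Rightarrow> complex"
  shows "(\<Sum>n<block (Suc K). of_real (inv_floor n) * (V n - V (Suc n))) =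
         (\<Sum>k<K. (V (block (Suc k)) - V (block (Suc (Suc k)))) / of_nat (Suc k))"
proof (induction K)
  case 0
  have "inv_floor n = 0" if "n < block 1" for n
  proof -
    have "\<not>log_floor n \<ge> int 1" using that unfolding log_floor_ge_iff by simp
    thus ?thesis by (simp add: inv_floor_def)
  qed
  thus ?case by simp
next
  case (Suc K)
  let ?g = "\<lambda>n. of_real (inv_floor n) * (V n - V (Suc n))"
  have le: "block (Suc K) \<le> block (Suc (Suc K))" by (rule block_mono) simp
  have "(\<Sum>n<block (Suc (Suc K)). ?g n) =
        (\<Sum>n<block (Suc K). ?g n) + (\<Sum>n=block (Suc K)..<block (Suc (Suc K)). ?g n)"
    unfolding lessThan_atLeast0 using le by (subst sum.atLeastLessThan_concat) auto
  also have "(\<Sum>n=block (Suc K)..<block (Suc (Suc K)). ?g n) =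
        (\<Sum>n=block (Suc K)..<block (Suc (Suc K)). (- 1 / of_nat (Suc K)) * (V (Suc n) - V n))"
  proof (intro sum.cong refl)
    fix n assume "n \<in> {block (Suc K)..<block (Suc (Suc K))}"
    hence "inv_floor n = 1 / real (Suc K)" by (intro inv_floor_block) auto
    hence "?g n = (1 / of_nat (Suc K)) * (V n - V (Suc n))" by (simp del: of_nat_Suc)
    also have "\<dots> = (- 1 / of_nat (Suc K)) * (V (Suc n) - V n)" by (simp add: algebra_simps del: of_nat_Suc)
    finally show "?g n = (- 1 / of_nat (Suc K)) * (V (Suc n) - V n)" .
  qed
  also have "\<dots> = (V (block (Suc K)) - V (block (Suc (Suc K)))) / of_nat (Suc K)"
    unfolding sum_distrib_left[symmetric] sum_Suc_diff'[OF le] by (simp add: field_simps del: of_nat_Suc)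
  finally show ?case using Suc.IH by simp
qed

text \<open>Closed form of the block sum after its integer ends are moved to exp(k + 1/2). With q =
  exp(-z), the factor q / (1 - q) sums q^k and -Ln(1 - q) sums q^k / k, both over k \<ge> 1.\<close>

definition floor_main :: "complex \<Rightarrow> complex" where
  "floor_main z = (exp (-z/2) - exp (-3*z/2)) / z * (exp (-z) / (1 - exp (-z)))
     - (exp (-z/2) * (1 / (2*z) + 1 / z^2) - exp (-3*z/2) * (3 / (2*z) + 1 / z^2)) * Ln (1 - exp (-z))"

text \<open>At exp(u) the function \<open>step_prim z\<close> is exp(-zu) (u/z + 1/z^2). For u = k +
  1/2 and u = k + 3/2, division by k splits u/k into 1 + 1/(2k) and 1 + 3/(2k), which separates the
  geometric from the logarithmic series.\<close>

lemma floor_main_sums: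
  assumes z: "Re z > 0"
  shows "(\<lambda>k. (step_prim z (exp (real (Suc k) + 1/2)) - step_prim z (exp (real (Suc (Suc k)) + 1/2))) / of_nat (Suc k))
           sums floor_main z"
proof -
  define q where "q = exp (-z)"
  define E where "E = (exp (-z/2) - exp (-3*z/2)) / z"
  define R where "R = exp (-z/2) * (1 / (2*z) + 1 / z^2) - exp (-3*z/2) * (3 / (2*z) + 1 / z^2)"
  have z0: "z \<noteq> 0" using z by auto
  have q: "norm q < 1" using z by (simp add: q_def)
  have "(\<lambda>k. E * (q * q ^ k)) sums (E * (q * (1 / (1 - q))))"
    by (intro sums_mult geometric_sums q)
  moreover have "(\<lambda>k. R * (q ^ Suc k / of_nat (Suc k))) sums (R * (- Ln (1 - q)))"
  proof (intro sums_mult)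
    have "(\<lambda>n. (-1) ^ Suc n / of_nat n * (-q) ^ n) sums Ln (1 + (-q))"
      using q by (intro Ln_series) auto
    hence "(\<lambda>n. - ((-1) ^ Suc n / of_nat n * (-q) ^ n)) sums - Ln (1 + (-q))" by (rule sums_minus)
    also have "(\<lambda>n. - ((-1) ^ Suc n / of_nat n * (-q) ^ n)) = (\<lambda>n. q ^ n / of_nat n)"
      by (auto simp: fun_eq_iff simp flip: power_mult_distrib)
    finally have "(\<lambda>n. q ^ n / of_nat n) sums - Ln (1 - q)" by simp
    thus "(\<lambda>n. q ^ Suc n / of_nat (Suc n)) sums - Ln (1 - q)"
      by (subst sums_Suc_iff) simp
  qed
  ultimately have "(\<lambda>k. E * (q * q ^ k) + R * (q ^ Suc k / of_nat (Suc k))) sums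
                     (E * (q * (1 / (1 - q))) + R * (- Ln (1 - q)))" by (rule sums_add)
  also have "(E * (q * (1 / (1 - q))) + R * (- Ln (1 - q))) = floor_main z"
    by (simp add: floor_main_def E_def R_def q_def)
  also have "(\<lambda>k. E * (q * q ^ k) + R * (q ^ Suc k / of_nat (Suc k))) =
     (\<lambda>k. (step_prim z (exp (real (Suc k) + 1/2)) - step_prim z (exp (real (Suc (Suc k)) + 1/2))) / of_nat (Suc k))"
  proof
    fix k
    define m :: complex where "m = of_nat (Suc k)"
    have m: "m \<noteq> 0" unfolding m_def by (simp del: of_nat_Suc)
    have step: "step_prim z (exp u) = exp (- z * of_real u) * (of_real u / z + 1 / z^2)" for u
      by (simp add: step_prim_def powr_def Ln_of_real mult.commute)
    have qm: "q ^ Suc k = exp (- z * m)"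
      unfolding q_def m_def by (subst exp_of_nat_mult [symmetric]) (simp add: mult.commute)
    have e1: "exp (- z * of_real (real (Suc k) + 1/2)) = q ^ Suc k * exp (-z/2)"
      unfolding qm exp_add[symmetric] by (rule arg_cong[of _ _ exp]) (simp add: m_def field_simps)
    have e3: "exp (- z * of_real (real (Suc (Suc k)) + 1/2)) = q ^ Suc k * exp (-3*z/2)"
      unfolding qm exp_add[symmetric] by (rule arg_cong[of _ _ exp]) (simp add: m_def field_simps)
    have u1: "complex_of_real (real (Suc k) + 1/2) = m + 1/2" by (simp add: m_def)
    have u2: "complex_of_real (real (Suc (Suc k)) + 1/2) = m + 3/2" by (simp add: m_def)
    have "(step_prim z (exp (real (Suc k) + 1/2)) - step_prim z (exp (real (Suc (Suc k)) + 1/2))) / m =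
       (q ^ Suc k * exp (-z/2) * ((m + 1/2) / z + 1 / z^2) - q ^ Suc k * exp (-3*z/2) * ((m + 3/2) / z + 1 / z^2)) / m"
      unfolding step e1 e3 unfolding u1 u2 ..
    also have "\<dots> = E * q ^ Suc k + R * (q ^ Suc k / m)"
      unfolding E_def R_def using z0 m by (simp add: divide_simps del: power_Suc) (simp add: algebra_simps del: power_Suc)
    finally show "E * (q * q ^ k) + R * (q ^ Suc k / of_nat (Suc k)) =
      (step_prim z (exp (real (Suc k) + 1/2)) - step_prim z (exp (real (Suc (Suc k)) + 1/2))) / of_nat (Suc k)"
      by (simp add: m_def)
  qed
  finally show ?thesis .
qed

definition block_err :: "nat \<Rightarrow> real" where
  "block_err k = (real k + 3/2) / exp (real k + 1/2)"

lemma summable_block_err: "summable block_err"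
proof (rule summable_comparison_test_bigo)
  show "summable (\<lambda>n. norm (real n powr -2))" by (simp add: summable_real_powr_iff)
  show "block_err \<in> O(\<lambda>n. real n powr -2)" unfolding block_err_def[abs_def] by real_asymp
qed

lemma step_prim_block:
  assumes "z \<noteq> 0" "Re z \<ge> 0"
  shows "norm (step_prim z (real (block k)) - step_prim z (exp (real k + 1/2))) \<le> block_err k"
proof -
  have "norm (step_prim z (real (block k)) - step_prim z (exp (real k + 1/2)))
          \<le> (1 + ln (exp (real k + 1/2))) / exp (real k + 1/2)"
    by (intro step_prim_diff assms block_bounds) simp
  thus ?thesis by (simp add: block_err_def add.commute)
qed

text \<open>Two errors occur: passing from terms to differences costs \<open>step_err\<close>, and
  rounding the two ends of every block costs \<open>block_err\<close> twice. Both totals are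
  independent of Re z.\<close>

lemma suminf_inv_floor:
  assumes z: "Re z > 0" and c: "norm z \<le> c"
  shows "summable (\<lambda>n. of_real (inv_floor n) * of_real (ln (real n)) * of_nat n powr (-z-1))" (is "summable ?f")
    and "norm ((\<Sum>n. of_real (inv_floor n) * of_real (ln (real n)) * of_nat n powr (-z-1)) - floor_main z)
           \<le> suminf (step_err c) + 2 * suminf block_err"
proof -
  have z0: "z \<noteq> 0" "Re z \<ge> 0" using z by auto
  have c0: "c \<ge> 0" using c norm_ge_zero order_trans by blast
  show summ: "summable ?f"
  proof (rule summable_comparison_test')
    show "summable (\<lambda>n. ln (real n) * real n powr (- Re z - 1))" using z by (intro summable_ln_powr) auto
    fix n :: nat assume "n \<ge> 0"
    have "norm (?f n) = inv_floor n * (ln (real n) * real n powr (- Re z - 1))"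
      by (simp add: norm_mult norm_of_nat_powr ln_of_nat_nonneg inv_floor_bounds)
    also have "\<dots> \<le> 1 * (ln (real n) * real n powr (- Re z - 1))"
      by (intro mult_right_mono inv_floor_bounds mult_nonneg_nonneg ln_of_nat_nonneg) auto
    finally show "norm (?f n) \<le> ln (real n) * real n powr (- Re z - 1)" by simp
  qed
  define V where "V = (\<lambda>n. step_prim z (real n))"
  define U where "U = (\<lambda>k. step_prim z (exp (real k + 1/2)))"
  have err: "norm (of_real (inv_floor n) * (V n - V (Suc n)) - ?f n) \<le> step_err c n" for n
  proof (cases "n = 0")
    case False
    have "of_real (inv_floor n) * (V n - V (Suc n)) - ?f n =
          of_real (inv_floor n) * (V n - V (Suc n) - of_real (ln (real n)) * of_nat n powr (-z-1))"
      by (simp add: algebra_simps)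
    hence "norm (of_real (inv_floor n) * (V n - V (Suc n)) - ?f n) =
          inv_floor n * norm (V n - V (Suc n) - of_real (ln (real n)) * of_nat n powr (-z-1))"
      by (simp only: norm_mult norm_of_real abs_of_nonneg inv_floor_bounds)
    also have "\<dots> \<le> 1 * ((1 + (1 + norm z) * ln (real n + 1)) * real n powr (- Re z - 2))"
      unfolding V_def using False z0 by (intro mult_mono step_prim_unit_step inv_floor_bounds) auto
    also have "\<dots> = (1 + (1 + norm z) * ln (real n + 1)) * real n powr (- Re z - 2) * real n powr 0"
      using False by simp
    also have "\<dots> \<le> step_err c n"
      using z c False by (intro norm_powr_le_step_err) auto
    finally show ?thesis .
  next
    case True
    have "log_floor 0 = -1" by (simp add: log_floor_def)
    thus ?thesis using True by (simp add: inv_floor_def step_err_def)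
  qed
  have bterm: "norm ((V (block (Suc k)) - V (block (Suc (Suc k)))) / of_nat (Suc k) - (U (Suc k) - U (Suc (Suc k))) / of_nat (Suc k))
                \<le> block_err (Suc k) + block_err (Suc (Suc k))" for k
  proof -
    have "norm ((V (block (Suc k)) - V (block (Suc (Suc k)))) / of_nat (Suc k) - (U (Suc k) - U (Suc (Suc k))) / of_nat (Suc k))
          = norm ((V (block (Suc k)) - U (Suc k)) - (V (block (Suc (Suc k))) - U (Suc (Suc k)))) / real (Suc k)"
      unfolding diff_divide_distrib[symmetric] norm_divide norm_of_nat by (simp add: algebra_simps)
    also have "\<dots> \<le> norm ((V (block (Suc k)) - U (Suc k)) - (V (block (Suc (Suc k))) - U (Suc (Suc k)))) / 1"
      by (intro divide_left_mono) auto
    also have "\<dots> \<le> norm (V (block (Suc k)) - U (Suc k)) + norm (V (block (Suc (Suc k))) - U (Suc (Suc k)))"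
      using norm_triangle_ineq4 by simp
    also have "\<dots> \<le> block_err (Suc k) + block_err (Suc (Suc k))"
      unfolding V_def U_def by (intro add_mono step_prim_block z0)
    finally show ?thesis .
  qed
  have be0: "block_err k \<ge> 0" for k by (simp add: block_err_def)
  have bsum: "(\<Sum>k<K. block_err (k + j)) \<le> suminf block_err" for K j
  proof -
    have "(\<Sum>k<K. block_err (k + j)) = sum block_err ((\<lambda>k. k + j) ` {..<K})"
      by (subst sum.reindex) (auto simp: inj_on_def)
    also have "\<dots> \<le> suminf block_err"
      by (intro sum_le_suminf summable_block_err be0) auto
    finally show ?thesis .
  qed
  \<comment> \<open>Partial sums are compared only at block ends; since the series converges, this
    subsequence determines its value.\<close>
  define X where "X = (\<lambda>K. (\<Sum>n<block (Suc K). ?f n) - (\<Sum>k<K. (U (Suc k) - U (Suc (Suc k))) / of_nat (Suc k)))"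
  have bound: "norm (X K) \<le> suminf (step_err c) + 2 * suminf block_err" for K
  proof -
    define P where "P = (\<Sum>n<block (Suc K). of_real (inv_floor n) * (V n - V (Suc n)))"
    have "norm (P - (\<Sum>n<block (Suc K). ?f n)) \<le> (\<Sum>n<block (Suc K). step_err c n)"
      unfolding P_def sum_subtractf[symmetric] by (intro sum_norm_le err)
    also have "\<dots> \<le> suminf (step_err c)"
      by (intro sum_le_suminf summable_step_err) (auto intro: step_err_nonneg c0)
    finally have 1: "norm (P - (\<Sum>n<block (Suc K). ?f n)) \<le> suminf (step_err c)" .
    have "norm (P - (\<Sum>k<K. (U (Suc k) - U (Suc (Suc k))) / of_nat (Suc k)))
            \<le> (\<Sum>k<K. block_err (Suc k) + block_err (Suc (Suc k)))"
      unfolding P_def sum_inv_floor_blocks sum_subtractf[symmetric] by (intro sum_norm_le bterm)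
    also have "\<dots> \<le> suminf block_err + suminf block_err"
      unfolding sum.distrib using bsum[of 1 K] bsum[of 2 K] by (intro add_mono) simp_all
    finally have 2: "norm (P - (\<Sum>k<K. (U (Suc k) - U (Suc (Suc k))) / of_nat (Suc k))) \<le> 2 * suminf block_err" by simp
    have X: "X K = (P - (\<Sum>k<K. (U (Suc k) - U (Suc (Suc k))) / of_nat (Suc k))) - (P - (\<Sum>n<block (Suc K). ?f n))"
      by (simp add: X_def)
    show ?thesis unfolding X by (rule order_trans[OF norm_triangle_ineq4]) (use 1 2 in simp)
  qed
  have "filterlim (\<lambda>K. block (Suc K)) at_top sequentially"
  proof (rule filterlim_at_top_mono[OF filterlim_ident], rule always_eventually, rule allI)
    fix K
    have "real K \<le> exp (real (Suc K) + 1/2)"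
      using exp_ge_add_one_self[of "real (Suc K) + 1/2"] by simp
    also have "\<dots> \<le> real (block (Suc K))" by (rule block_bounds)
    finally show "K \<le> block (Suc K)" by simp
  qed
  from filterlim_compose[OF summable_LIMSEQ[OF summ] this]
  have "(\<lambda>K. \<Sum>n<block (Suc K). ?f n) \<longlonglongrightarrow> suminf ?f" .
  moreover have "(\<lambda>K. \<Sum>k<K. (U (Suc k) - U (Suc (Suc k))) / of_nat (Suc k)) \<longlonglongrightarrow> floor_main z"
    using floor_main_sums[OF z] unfolding sums_def U_def .
  ultimately have "X \<longlonglongrightarrow> suminf ?f - floor_main z" unfolding X_def by (rule tendsto_diff)
  from Lim_norm_ubound[OF sequentially_bot this always_eventually] bound
  show "norm (suminf ?f - floor_main z) \<le> suminf (step_err c) + 2 * suminf block_err" by blast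
qed

section \<open>The sign of the difference\<close>

definition excess :: "nat \<Rightarrow> real" where
  "excess n = inv_floor n * real n - real (prime_pi n)"

definition excess_series :: "complex \<Rightarrow> complex" where
  "excess_series z = (\<Sum>n. of_real (excess n) * of_real (ln (real n)) * of_nat n powr (-z-2))"

text \<open>The bound c covers z for the floor half and 1 + z for the prime half, and the resulting
  constant does not change as Re z \<rightarrow> 0 with c fixed.\<close>

lemma excess_series:
  assumes z: "Re z > 0" and c: "norm z + 1 \<le> c"
  shows "summable (\<lambda>n. of_real (excess n) * of_real (ln (real n)) * of_nat n powr (-z-2))"
    and "norm (excess_series z - (floor_main z - (prime_S1 (1 + z) / (1 + z) + prime_S0 (1 + z) / (1 + z) ^ 2)))
           \<le> 2 * suminf (step_err c) + 2 * suminf block_err"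
proof -
  have c1: "norm (1 + z) \<le> c" "norm z \<le> c" using c norm_triangle_ineq[of 1 z] by auto
  let ?P = "\<lambda>n. of_nat (prime_pi n) * of_real (ln (real n)) * of_nat n powr (-z-2)"
  let ?F = "\<lambda>n. of_real (inv_floor n) * of_real (ln (real n)) * of_nat n powr (-z-1)"
  have eq: "of_real (excess n) * of_real (ln (real n)) * of_nat n powr (-z-2) = ?F n - ?P n" for n
  proof (cases "n = 0")
    case False
    have "-z-2 = -z-1-1" by simp
    hence "(of_nat n :: complex) powr (-z-2) = of_nat n powr (-z-1) / of_nat n"
      using powr_diff[of "of_nat n" "-z-1" 1] False by (simp only: powr_one) simp
    hence "(of_nat n :: complex) powr (-z-1) = of_nat n * of_nat n powr (-z-2)"
      using False by simp
    thus ?thesis by (simp add: excess_def algebra_simps)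
  qed auto
  note P = suminf_prime_pi[OF z c1(1)] and F = suminf_inv_floor[OF z c1(2)]
  show "summable (\<lambda>n. of_real (excess n) * of_real (ln (real n)) * of_nat n powr (-z-2))"
    unfolding eq by (intro summable_diff P F)
  have "excess_series z = suminf ?F - suminf ?P"
    unfolding excess_series_def eq by (rule suminf_diff[symmetric]) (intro P F)+
  hence split: "excess_series z - (floor_main z - Q) = (suminf ?F - floor_main z) - (suminf ?P - Q)" for Q
    by simp
  show "norm (excess_series z - (floor_main z - (prime_S1 (1 + z) / (1 + z) + prime_S0 (1 + z) / (1 + z) ^ 2)))
           \<le> 2 * suminf (step_err c) + 2 * suminf block_err"
    unfolding split by (rule order_trans[OF norm_triangle_ineq4]) (use P(2) F(2) in linarith)
qed

text \<open>The factor n powr (-iy) has modulus 1, so the triangle inequality bounds the series by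
  the sum of the absolute values of its terms at y = 0. With a constant sign from n0 on, this is the
  value at sigma up to finitely many terms, and K pays for those uniformly in sigma and y.\<close>

lemma excess_series_one_sided:
  fixes \<epsilon> :: real
  assumes eps: "\<epsilon> \<in> {-1, 1}" and sgn: "\<And>n. n \<ge> n0 \<Longrightarrow> \<epsilon> * excess n \<ge> 0"
  obtains K where "\<And>\<sigma> y. \<sigma> > 0 \<Longrightarrow> norm (excess_series (Complex \<sigma> y)) \<le> norm (excess_series (of_real \<sigma>)) + K"
proof -
  define K where "K = 2 * (\<Sum>n<n0. \<bar>excess n\<bar> * ln (real n))"
  have "norm (excess_series (Complex \<sigma> y)) \<le> norm (excess_series (of_real \<sigma>)) + K" if \<sigma>: "\<sigma> > 0" for \<sigma> y :: real
  proof -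
    define w where "w = (\<lambda>n::nat. ln (real n) * real n powr (-\<sigma>-2))"
    have w0: "w n \<ge> 0" for n by (simp add: w_def ln_of_nat_nonneg)
    have "summable (\<lambda>n. of_real (excess n) * of_real (ln (real n)) * of_nat n powr (- of_real \<sigma> -2) :: complex)"
      by (rule excess_series(1)[OF _ order_refl]) (use \<sigma> in simp)
    also have eq: "(\<lambda>n. of_real (excess n) * of_real (ln (real n)) * of_nat n powr (- of_real \<sigma> -2) :: complex) =
                 (\<lambda>n. of_real (excess n * w n))"
    proof
      fix n
      have "of_nat n powr (- of_real \<sigma> - 2) = (of_real (real n powr (-\<sigma>-2)) :: complex)"
        by (subst powr_of_real [symmetric]) auto
      thus "of_real (excess n) * of_real (ln (real n)) * of_nat n powr (- of_real \<sigma> -2) = (of_real (excess n * w n) :: complex)"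
        by (simp add: w_def)
    qed
    finally have "summable (\<lambda>n. of_real (excess n * w n) :: complex)" .
    from summable_Re[OF this] have summ: "summable (\<lambda>n. excess n * w n)" by simp
    have real: "excess_series (of_real \<sigma>) = of_real (\<Sum>n. excess n * w n)"
      using sums_of_real[OF summable_sums[OF summ], where 'a = complex]
      unfolding excess_series_def eq by (simp only: sums_iff)
    \<comment> \<open>Early terms may have the wrong sign; adding twice the absolute value restores
      a majorant, since x + 2 \<bar>x\<bar> \<ge> \<bar>x\<bar>.\<close>
    define b where "b = (\<lambda>n. \<epsilon> * (excess n * w n) + 2 * (if n < n0 then \<bar>excess n\<bar> * w n else 0))"
    have fin: "(\<lambda>n. if n \<in> {..<n0} then \<bar>excess n\<bar> * w n else 0) sums (\<Sum>n<n0. \<bar>excess n\<bar> * w n)"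
      by (rule sums_If_finite_set) auto
    have "b sums (\<epsilon> * (\<Sum>n. excess n * w n) + 2 * (\<Sum>n<n0. \<bar>excess n\<bar> * w n))"
      unfolding b_def by (intro sums_add sums_mult summable_sums[OF summ]) (use fin in simp)
    hence b: "summable b" "suminf b = \<epsilon> * (\<Sum>n. excess n * w n) + 2 * (\<Sum>n<n0. \<bar>excess n\<bar> * w n)"
      by (simp_all add: sums_iff)
    have "norm (excess_series (Complex \<sigma> y)) \<le> suminf b"
      unfolding excess_series_def
    proof (rule norm_suminf_le[OF _ b(1)])
      fix n
      have "norm (of_real (excess n) * of_real (ln (real n)) * of_nat n powr (- Complex \<sigma> y -2) :: complex) = \<bar>excess n\<bar> * w n"
        by (simp add: norm_mult norm_of_nat_powr w_def ln_of_nat_nonneg)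
      also have "\<bar>excess n\<bar> * w n \<le> b n"
      proof (cases "n < n0")
        case True
        have "\<bar>\<epsilon> * (excess n * w n)\<bar> = \<bar>excess n\<bar> * w n"
          using eps w0[of n] by (auto simp: abs_mult)
        moreover have "b n = \<epsilon> * (excess n * w n) + 2 * (\<bar>excess n\<bar> * w n)"
          using True by (simp add: b_def)
        ultimately show ?thesis using abs_ge_minus_self[of "\<epsilon> * (excess n * w n)"] by linarith
      next
        case False
        have "\<bar>excess n\<bar> = \<epsilon> * excess n" using eps sgn[of n] False by auto
        thus ?thesis using False by (simp add: b_def mult.assoc)
      qed
      finally show "norm (of_real (excess n) * of_real (ln (real n)) * of_nat n powr (- Complex \<sigma> y -2) :: complex) \<le> b n" .
    qed
    also have "suminf b \<le> norm (excess_series (of_real \<sigma>)) + K"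
    proof -
      have "\<epsilon> * (\<Sum>n. excess n * w n) \<le> norm (excess_series (of_real \<sigma>))"
        using eps unfolding real by auto
      moreover have "(\<Sum>n<n0. \<bar>excess n\<bar> * w n) \<le> (\<Sum>n<n0. \<bar>excess n\<bar> * ln (real n))"
      proof (intro sum_mono mult_left_mono)
        fix n
        show "w n \<le> ln (real n)"
        proof (cases "n = 0")
          case False
          have "real n powr (-\<sigma>-2) \<le> real n powr 0" using \<sigma> False by (intro powr_mono) auto
          thus ?thesis using False ln_of_nat_nonneg[of n] by (auto simp: w_def intro: mult_left_le)
        qed (simp add: w_def)
      qed auto
      ultimately show ?thesis unfolding b(2) K_def by simp
    qed
    finally show ?thesis .
  qed
  thus ?thesis using that by blast
qed

section \<open>Behaviour of the excess series near 0 and near 2 pi i\<close>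

definition floor_main_real :: "real \<Rightarrow> real" where
  "floor_main_real x = (exp (-x/2) - exp (-3*x/2)) / x * (exp (-x) / (1 - exp (-x)))
     - (exp (-x/2) * (1 / (2*x) + 1 / x^2) - exp (-3*x/2) * (3 / (2*x) + 1 / x^2)) * ln (1 - exp (-x))"

text \<open>Reduces the expansion at 0 to a real function, to which \<open>real_asymp\<close>
  applies.\<close>

lemma floor_main_of_real:
  assumes "x > 0"
  shows "floor_main (of_real x) = of_real (floor_main_real x)"
proof -
  have "complex_of_real (ln (1 - exp (-x))) = Ln (1 - exp (- of_real x))"
    using assms by (subst Ln_of_real [symmetric]) (auto simp flip: exp_of_real)
  moreover have "complex_of_real (exp (-x/2)) = exp (- of_real x / 2)" "complex_of_real (exp (-3*x/2)) = exp (-3 * of_real x / 2)"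
     "complex_of_real (exp (-x)) = exp (- of_real x)"
    by (simp_all flip: exp_of_real)
  ultimately show ?thesis unfolding floor_main_def floor_main_real_def
    by simp
qed

lemma excess_series_real_bounded:
  obtains C where "\<forall>\<^sub>F \<sigma> in at_right 0. norm (excess_series (of_real \<sigma>)) \<le> C"
proof -
  obtain m C d :: real where d: "d > 0" and m: "(0::real) = 0 \<Longrightarrow> m = -1" and
    C1: "\<And>\<sigma>. \<sigma> \<in> {0<..<d} \<Longrightarrow> norm (prime_S1 (1 + Complex \<sigma> 0) + of_real (m / \<sigma>)) \<le> C" and
    C0: "\<And>\<sigma>. \<sigma> \<in> {0<..<d} \<Longrightarrow> norm (prime_S0 (1 + Complex \<sigma> 0) - of_real (m * ln \<sigma>)) \<le> C"
    by (rule prime_S0_S1_asymp[of 0]) (rule that)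
  \<comment> \<open>The sum of the explicit singular parts. Its first term is 1/sigma - ln sigma +
    O(1): in the coefficient of the logarithm the two terms of order 1/sigma cancel and leave 1. The
    prime terms with m = -1 remove exactly these singularities.\<close>
  define M where "M = (\<lambda>\<sigma>. floor_main_real \<sigma> - (1 / \<sigma>) / (1 + \<sigma>) + ln \<sigma> / (1 + \<sigma>) ^ 2)"
  have "M \<in> O[at_right 0](\<lambda>_. 1)"
    unfolding M_def floor_main_real_def by real_asymp
  then obtain B where B: "\<forall>\<^sub>F \<sigma> in at_right 0. norm (M \<sigma>) \<le> B * norm (1::real)"
    by (rule landau_o.bigE)
  \<comment> \<open>The constant 2 bounds norm z + 1 for z = sigma < 1.\<close>
  define A where "A = 2 * suminf (step_err 2) + 2 * suminf block_err"
  have "\<forall>\<^sub>F \<sigma> in at_right 0. \<sigma> \<in> {0<..<min d 1}"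
    using d by (intro eventually_at_right_real) auto
  hence "\<forall>\<^sub>F \<sigma> in at_right 0. norm (excess_series (of_real \<sigma>)) \<le> A + B + C + C"
    using B
  proof eventually_elim
    case (elim \<sigma>)
    define s where "s = 1 + complex_of_real \<sigma>"
    have "s = of_real (1 + \<sigma>)" by (simp add: s_def)
    hence s1: "norm s \<ge> 1" using elim by (simp only: norm_of_real) auto
    have s0: "s \<noteq> 0" using s1 by auto
    have cx: "Complex \<sigma> 0 = of_real \<sigma>" by (simp add: complex_eq_iff)
    have "m = -1" using m by simp
    define e1 where "e1 = prime_S1 s - of_real (1 / \<sigma>)"
    define e0 where "e0 = prime_S0 s + of_real (ln \<sigma>)"
    have e1: "norm e1 \<le> C" using C1[of \<sigma>] elim \<open>m = -1\<close> by (simp add: e1_def s_def cx)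
    have e0: "norm e0 \<le> C" using C0[of \<sigma>] elim \<open>m = -1\<close> by (simp add: e0_def s_def cx)
    have tri: "norm x \<le> norm (x - (u - (v + w))) + norm u + norm v + norm w" for x u v w :: complex
      using norm_triangle_ineq[of "x - (u - (v + w))" "u - (v + w)"]
        norm_triangle_ineq4[of u "v + w"] norm_triangle_ineq[of v w] by simp
    have H: "norm (excess_series (of_real \<sigma>) - (floor_main (of_real \<sigma>) - (prime_S1 s / s + prime_S0 s / s ^ 2))) \<le> A"
      unfolding A_def s_def by (rule excess_series(2)) (use elim in auto)
    have eqM: "floor_main (of_real \<sigma>) - (prime_S1 s / s + prime_S0 s / s ^ 2) = of_real (M \<sigma>) - (e1 / s + e0 / s ^ 2)"
    proof -
      have "prime_S1 s = of_real (1 / \<sigma>) + e1" "prime_S0 s = e0 - of_real (ln \<sigma>)" by (simp_all add: e1_def e0_def)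
      moreover have "floor_main (of_real \<sigma>) = of_real (floor_main_real \<sigma>)" using elim by (intro floor_main_of_real) auto
      moreover have "complex_of_real (M \<sigma>) = of_real (floor_main_real \<sigma>) - of_real (1 / \<sigma>) / s + of_real (ln \<sigma>) / s ^ 2"
        by (simp add: M_def s_def)
      ultimately show ?thesis by (simp add: add_divide_distrib diff_divide_distrib)
    qed
    note H[unfolded eqM]
    moreover have "norm (e1 / s) \<le> C" "norm (e0 / s ^ 2) \<le> C"
    proof -
      have "norm (e1 / s) \<le> norm e1 / 1" unfolding norm_divide using s1 by (intro divide_left_mono) auto
      thus "norm (e1 / s) \<le> C" using e1 by simp
      have "norm (e0 / s ^ 2) \<le> norm e0 / 1" unfolding norm_divide norm_power using s1
        by (intro divide_left_mono) (auto simp: one_le_power)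
      thus "norm (e0 / s ^ 2) \<le> C" using e0 by simp
    qed
    moreover have "norm (complex_of_real (M \<sigma>)) \<le> B" using elim by simp
    moreover note tri[of "excess_series (of_real \<sigma>)" "of_real (M \<sigma>)" "e1 / s" "e0 / s ^ 2"]
    ultimately show ?case by linarith
  qed
  thus ?thesis using that by blast
qed

text \<open>At \<open>z = \<sigma> + 2\<pi>i\<close> one has \<open>exp (-z) = exp (-\<sigma>)\<close>, so the logarithm in \<open>floor_main\<close> is as large as at \<open>\<sigma>\<close>;
  its coefficient does not vanish there as it is about \<open>- 1 / z\<close>.\<close>

lemma norm_floor_main_2pi_le:
  assumes "\<sigma> > 0"
  defines "z \<equiv> Complex \<sigma> (2 * pi)" and "a \<equiv> exp (-\<sigma>/2)" and "b \<equiv> exp (-3*\<sigma>/2)" and "l \<equiv> ln (1 - exp (-\<sigma>))"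
  shows "norm (floor_main z - of_real ((a - 3 * b) * l / 2) / z)
           \<le> \<bar>a - b\<bar> * (exp (-\<sigma>) / (1 - exp (-\<sigma>))) + \<bar>a - b\<bar> * \<bar>l\<bar>"
proof -
  have pi3: "3 * pi = pi + 2 * pi" by simp
  have c3: "cos (3 * pi) = -1" "sin (3 * pi) = 0" unfolding pi3 by (simp_all only: cos_periodic sin_periodic cos_pi sin_pi)
  have 1: "exp (-z/2) = - of_real a"
    by (simp add: complex_eq_iff Re_exp Im_exp z_def a_def)
  have 3: "exp (-3*z/2) = - of_real b"
    using c3 by (simp add: complex_eq_iff Re_exp Im_exp z_def b_def)
  have 2: "exp (-z) = of_real (exp (-\<sigma>))"
    by (simp add: complex_eq_iff Re_exp Im_exp z_def)
  have l: "Ln (1 - complex_of_real (exp (-\<sigma>))) = of_real l"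
    unfolding l_def using assms(1) by (subst Ln_of_real [symmetric]) auto
  have z1: "norm z \<ge> 1"
    using abs_Im_le_cmod[of z] pi_gt3 by (simp add: z_def)
  have z0: "z \<noteq> 0" using z1 by auto
  define q where "q = exp (-\<sigma>)"
  have q: "0 < q" "q < 1" using assms(1) by (auto simp: q_def)
  \<comment> \<open>Both half-integer exponentials change sign at 2 pi i, while exp(-z) does not. In
    the regrouped form a - 3b tends to -2 and keeps the logarithm alive, while a - b is of order
    sigma and tames both the pole of q / (1 - q) and the remaining logarithm.\<close>
  have split: "floor_main z - of_real ((a - 3 * b) * l / 2) / z =
         of_real (- (a - b) * (q / (1 - q))) / z + of_real ((a - b) * l) / z ^ 2"
  proof -
    define r where "r = complex_of_real q / (1 - of_real q)"
    have r: "complex_of_real (q / (1 - q)) = r" by (simp add: r_def)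
    have "floor_main z = (- of_real a - - of_real b) / z * r
     - ((- of_real a) * (1 / (2*z) + 1 / z^2) - (- of_real b) * (3 / (2*z) + 1 / z^2)) * of_real l"
      unfolding floor_main_def 1 3 2 l q_def r_def ..
    thus ?thesis unfolding of_real_mult r using z0
      by (simp add: divide_simps) (simp add: algebra_simps power2_eq_square)
  qed
  have "norm (floor_main z - of_real ((a - 3 * b) * l / 2) / z)
          \<le> norm (of_real (- (a - b) * (q / (1 - q))) / z) + norm (of_real ((a - b) * l) / z ^ 2)"
    unfolding split by (rule norm_triangle_ineq)
  also have "norm (of_real (- (a - b) * (q / (1 - q))) / z) \<le> \<bar>- (a - b) * (q / (1 - q))\<bar> / 1"
    unfolding norm_divide norm_of_real using z1 by (intro divide_left_mono) auto
  also have "norm (of_real ((a - b) * l) / z ^ 2) \<le> \<bar>(a - b) * l\<bar> / 1"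
    unfolding norm_divide norm_of_real norm_power using z1 by (intro divide_left_mono) (auto simp: one_le_power)
  also have "\<bar>- (a - b) * (q / (1 - q))\<bar> / 1 + \<bar>(a - b) * l\<bar> / 1 = \<bar>a - b\<bar> * (q / (1 - q)) + \<bar>a - b\<bar> * \<bar>l\<bar>"
    using q by (simp add: abs_mult)
  finally show ?thesis by (simp add: q_def)
qed

text \<open>Either \<open>m \<noteq> 0\<close> and the term \<open>m / \<sigma>\<close> dominates all logarithms, or \<open>m = 0\<close> and the prime sums stay
  bounded while \<open>floor_main\<close> does not.\<close>

lemma excess_series_2pi_unbounded:
  "\<not> (\<forall>\<^sub>F \<sigma> in at_right 0. norm (excess_series (Complex \<sigma> (2 * pi))) \<le> K)"
proof
  assume K: "\<forall>\<^sub>F \<sigma> in at_right 0. norm (excess_series (Complex \<sigma> (2 * pi))) \<le> K"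
  obtain m C d :: real where d: "d > 0" and "2 * pi = 0 \<Longrightarrow> m = -1" and
    C1: "\<And>\<sigma>. \<sigma> \<in> {0<..<d} \<Longrightarrow> norm (prime_S1 (1 + Complex \<sigma> (2 * pi)) + of_real (m / \<sigma>)) \<le> C" and
    C0: "\<And>\<sigma>. \<sigma> \<in> {0<..<d} \<Longrightarrow> norm (prime_S0 (1 + Complex \<sigma> (2 * pi)) - of_real (m * ln \<sigma>)) \<le> C"
    by (rule prime_S0_S1_asymp[of "2 * pi"]) (rule that)
  define l where "l = (\<lambda>\<sigma>::real. ln (1 - exp (-\<sigma>)))"
  define a where "a = (\<lambda>\<sigma>::real. exp (-\<sigma>/2))"
  define b where "b = (\<lambda>\<sigma>::real. exp (-3*\<sigma>/2))"
  define T where "T = (\<lambda>\<sigma>. (a \<sigma> - 3 * b \<sigma>) * l \<sigma> / 2)"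
  define M where "M = (\<lambda>\<sigma>. \<bar>a \<sigma> - b \<sigma>\<bar> * (exp (-\<sigma>) / (1 - exp (-\<sigma>))) + \<bar>a \<sigma> - b \<sigma>\<bar> * \<bar>l \<sigma>\<bar>)"
  have "M \<in> O[at_right 0](\<lambda>_. 1)"
    unfolding M_def a_def b_def l_def by real_asymp
  then obtain B where B: "\<forall>\<^sub>F \<sigma> in at_right 0. norm (M \<sigma>) \<le> B * norm (1::real)"
    by (rule landau_o.bigE)
  \<comment> \<open>Here norm z \<le> 8 for sigma < 1, since 2 pi < 7, so norm z + 1 \<le>
    9.\<close>
  define A where "A = 2 * suminf (step_err 9) + 2 * suminf block_err"
  define J where "J = (\<lambda>\<sigma>. of_real (T \<sigma>) / Complex \<sigma> (2 * pi))"
  define N where "N = (\<lambda>\<sigma>. of_real (m / \<sigma>) / (1 + Complex \<sigma> (2 * pi)))"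
  define N' where "N' = (\<lambda>\<sigma>. of_real (m * ln \<sigma>) / (1 + Complex \<sigma> (2 * pi)) ^ 2)"
  have ev: "\<forall>\<^sub>F \<sigma> in at_right 0. \<sigma> \<in> {0<..<min d 1}"
    using d by (intro eventually_at_right_real) auto
  have zbd: "1 \<le> norm (Complex \<sigma> (2*pi))" "norm (Complex \<sigma> (2*pi)) \<le> 8"
            "1 \<le> norm (1 + Complex \<sigma> (2*pi))" "norm (1 + Complex \<sigma> (2*pi)) \<le> 9" if "\<sigma> \<in> {0<..<1}" for \<sigma>
  proof -
    show "1 \<le> norm (Complex \<sigma> (2*pi))"
      using abs_Im_le_cmod[of "Complex \<sigma> (2*pi)"] pi_gt3 by simp
    show le8: "norm (Complex \<sigma> (2*pi)) \<le> 8"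
      using cmod_le[of "Complex \<sigma> (2*pi)"] that pi_less_4 pi_approx by simp
    show "1 \<le> norm (1 + Complex \<sigma> (2*pi))"
      using abs_Re_le_cmod[of "1 + Complex \<sigma> (2*pi)"] that by simp
    show "norm (1 + Complex \<sigma> (2*pi)) \<le> 9"
      using norm_triangle_ineq[of 1 "Complex \<sigma> (2*pi)"] le8 by simp
  qed
  have main: "\<forall>\<^sub>F \<sigma> in at_right 0. norm (J \<sigma> + N \<sigma> - N' \<sigma>) \<le> A + B + C + C + K"
    using B K ev
  proof eventually_elim
    case (elim \<sigma>)
    define z where "z = Complex \<sigma> (2 * pi)"
    define s where "s = 1 + z"
    have \<sigma>: "\<sigma> \<in> {0<..<1}" using elim by auto
    have s1: "norm s \<ge> 1" using zbd(3)[OF \<sigma>] by (simp add: s_def z_def)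
    define e1 where "e1 = prime_S1 s + of_real (m / \<sigma>)"
    define e0 where "e0 = prime_S0 s - of_real (m * ln \<sigma>)"
    define f where "f = floor_main z - J \<sigma>"
    have e1: "norm e1 \<le> C" using C1[of \<sigma>] elim by (simp add: e1_def s_def z_def)
    have e0: "norm e0 \<le> C" using C0[of \<sigma>] elim by (simp add: e0_def s_def z_def)
    have e1': "norm (e1 / s) \<le> C"
    proof -
      have "norm (e1 / s) \<le> norm e1 / 1" unfolding norm_divide using s1 by (intro divide_left_mono) auto
      thus ?thesis using e1 by simp
    qed
    have e0': "norm (e0 / s ^ 2) \<le> C"
    proof -
      have "norm (e0 / s ^ 2) \<le> norm e0 / 1" unfolding norm_divide norm_power using s1
        by (intro divide_left_mono) (auto simp: one_le_power)
      thus ?thesis using e0 by simp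
    qed
    have f: "norm f \<le> B"
      using norm_floor_main_2pi_le[of \<sigma>] elim
      by (simp add: f_def J_def T_def M_def a_def b_def l_def z_def)
    have H: "norm (excess_series z - (floor_main z - (prime_S1 s / s + prime_S0 s / s ^ 2))) \<le> A"
      unfolding A_def s_def by (rule excess_series(2)) (use \<sigma> zbd(2)[OF \<sigma>] in \<open>auto simp: z_def\<close>)
    have Kz: "norm (excess_series z) \<le> K" using elim by (simp add: z_def)
    have "J \<sigma> + N \<sigma> - N' \<sigma> = excess_series z - (excess_series z - (floor_main z - (prime_S1 s / s + prime_S0 s / s ^ 2)))
             - f + e1 / s + e0 / s ^ 2"
    proof -
      have "prime_S1 s = e1 - of_real (m / \<sigma>)" "prime_S0 s = e0 + of_real (m * ln \<sigma>)" by (simp_all add: e1_def e0_def)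
      moreover have "floor_main z = f + J \<sigma>" by (simp add: f_def)
      moreover have "N \<sigma> = of_real (m / \<sigma>) / s" "N' \<sigma> = of_real (m * ln \<sigma>) / s ^ 2"
        by (simp_all add: N_def N'_def s_def z_def)
      ultimately show ?thesis by (simp add: add_divide_distrib diff_divide_distrib)
    qed
    moreover have "norm (x - y - u + v + w) \<le> norm x + norm y + norm u + norm v + norm w" for x y u v w :: complex
      by (intro norm_triangle_le norm_triangle_le_diff add_mono order_refl)
    ultimately have "norm (J \<sigma> + N \<sigma> - N' \<sigma>) \<le> norm (excess_series z) +
       norm (excess_series z - (floor_main z - (prime_S1 s / s + prime_S0 s / s ^ 2))) + norm f + norm (e1 / s) + norm (e0 / s ^ 2)"
      by metis
    thus ?case using e1' e0' f H Kz by linarith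
  qed
  define L where "L = A + B + C + C + K"
  have "m = 0"
  proof -
    \<comment> \<open>Isolates the pole term and multiplies by sigma. Everything else grows at most
      logarithmically, so the right side tends to 0.\<close>
    have "\<forall>\<^sub>F \<sigma> in at_right 0. \<bar>m\<bar> / 9 \<le> \<sigma> * (L + \<bar>T \<sigma>\<bar> + \<bar>m * ln \<sigma>\<bar>)"
      using main ev
    proof eventually_elim
      case (elim \<sigma>)
      have \<sigma>: "\<sigma> \<in> {0<..<1}" using elim by auto
      note zb = zbd[OF \<sigma>]
      have "\<bar>m\<bar> / \<sigma> / 9 \<le> norm (N \<sigma>)"
        unfolding N_def norm_divide norm_of_real using zb \<sigma> by (auto simp: abs_divide intro!: divide_left_mono mult_pos_pos)
      also have "norm (N \<sigma>) \<le> norm (J \<sigma> + N \<sigma> - N' \<sigma>) + norm (J \<sigma>) + norm (N' \<sigma>)"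
      proof -
        have "N \<sigma> = (J \<sigma> + N \<sigma> - N' \<sigma>) - J \<sigma> + N' \<sigma>" by simp
        moreover have "norm (x - u + v) \<le> norm x + norm u + norm v" for x u v :: complex
          by (intro norm_triangle_le norm_triangle_le_diff add_mono order_refl)
        ultimately show ?thesis by metis
      qed
      also have "norm (J \<sigma>) \<le> \<bar>T \<sigma>\<bar> / 1"
        unfolding J_def norm_divide norm_of_real using zb by (intro divide_left_mono) auto
      also have "norm (N' \<sigma>) \<le> \<bar>m * ln \<sigma>\<bar> / 1"
        unfolding N'_def norm_divide norm_of_real norm_power using zb by (intro divide_left_mono) (auto simp: one_le_power)
      finally have "\<bar>m\<bar> / \<sigma> / 9 \<le> L + \<bar>T \<sigma>\<bar> + \<bar>m * ln \<sigma>\<bar>"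
        using elim by (simp add: L_def)
      hence "\<sigma> * (\<bar>m\<bar> / \<sigma> / 9) \<le> \<sigma> * (L + \<bar>T \<sigma>\<bar> + \<bar>m * ln \<sigma>\<bar>)"
        using \<sigma> by (intro mult_left_mono) auto
      thus ?case using \<sigma> by simp
    qed
    hence le: "\<forall>\<^sub>F \<sigma> in at_right 0. \<bar>m\<bar> / 9 \<le> \<sigma> * L + \<bar>\<sigma> * T \<sigma>\<bar> + \<bar>m\<bar> * \<bar>\<sigma> * ln \<sigma>\<bar>"
      using ev by eventually_elim (simp add: abs_mult algebra_simps)
    have "((\<lambda>\<sigma>. \<sigma> * L + \<bar>\<sigma> * T \<sigma>\<bar> + \<bar>m\<bar> * \<bar>\<sigma> * ln \<sigma>\<bar>) \<longlongrightarrow> 0 * L + \<bar>0\<bar> + \<bar>m\<bar> * \<bar>0\<bar>) (at_right 0)"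
    proof (intro tendsto_intros)
      show "((\<lambda>\<sigma>. \<sigma> * T \<sigma>) \<longlongrightarrow> 0) (at_right 0)"
        unfolding T_def a_def b_def l_def by real_asymp
      show "((\<lambda>\<sigma>::real. \<sigma> * ln \<sigma>) \<longlongrightarrow> 0) (at_right 0)" by real_asymp
    qed
    from tendsto_lowerbound[OF this le] have "\<bar>m\<bar> / 9 \<le> 0" by simp
    thus "m = 0" by simp
  qed
  have "\<forall>\<^sub>F \<sigma> in at_right 0. \<bar>T \<sigma>\<bar> / 8 \<le> L"
    using main ev
  proof eventually_elim
    case (elim \<sigma>)
    have \<sigma>: "\<sigma> \<in> {0<..<1}" using elim by auto
    note zb = zbd[OF \<sigma>]
    have "\<bar>T \<sigma>\<bar> / 8 \<le> norm (J \<sigma>)"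
      unfolding J_def norm_divide norm_of_real by (intro divide_left_mono zb mult_pos_pos less_le_trans[OF zero_less_one zb(1)]) auto
    thus ?case using elim(1) \<open>m = 0\<close> by (simp add: N_def N'_def L_def)
  qed
  \<comment> \<open>T behaves like -ln sigma, as a - 3b tends to -2.\<close>
  moreover have "filterlim (\<lambda>\<sigma>. \<bar>T \<sigma>\<bar> / 8) at_top (at_right 0)"
    unfolding T_def a_def b_def l_def by real_asymp
  hence "\<forall>\<^sub>F \<sigma> in at_right 0. \<bar>T \<sigma>\<bar> / 8 > L"
    by (simp add: filterlim_at_top_dense)
  ultimately have "\<forall>\<^sub>F \<sigma> in at_right (0::real). False"
    by eventually_elim auto
  thus False by simp
qed

lemma excess_not_one_sided:
  assumes "\<epsilon> \<in> {-1, 1 :: real}"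
  shows "\<not> (\<forall>n\<ge>n0. \<epsilon> * excess n \<ge> 0)"
proof
  assume *: "\<forall>n\<ge>n0. \<epsilon> * excess n \<ge> 0"
  obtain K where K: "\<And>\<sigma> y. \<sigma> > 0 \<Longrightarrow> norm (excess_series (Complex \<sigma> y)) \<le> norm (excess_series (of_real \<sigma>)) + K"
    by (rule excess_series_one_sided[OF assms, of n0]) (use * in blast)+
  obtain C where C: "\<forall>\<^sub>F \<sigma> in at_right 0. norm (excess_series (of_real \<sigma>)) \<le> C"
    by (rule excess_series_real_bounded)
  have "\<forall>\<^sub>F \<sigma> in at_right 0. norm (excess_series (Complex \<sigma> (2 * pi))) \<le> C + K"
    using C eventually_at_right_less[of 0]
  proof eventually_elim
    case (elim \<sigma>)
    thus ?case using K[of \<sigma> "2 * pi"] by simp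
  qed
  thus False using excess_series_2pi_unbounded by blast
qed

section \<open>From sign changes to exact zeros\<close>

text \<open>A discrete intermediate value argument: a positive integer that drops by at most 1 is
  still nonnegative, and 0 is excluded, so a positive value stays positive for ever. Upward jumps
  are unrestricted, which is why the two alternatives are not symmetric.\<close>

lemma int_seq_one_sided:
  fixes g :: "nat \<Rightarrow> int"
  assumes step: "\<And>n. n \<ge> N \<Longrightarrow> g (Suc n) \<ge> g n - 1" and nz: "\<And>n. n \<ge> N \<Longrightarrow> g n \<noteq> 0"
  shows "(\<exists>M\<ge>N. \<forall>n\<ge>M. g n > 0) \<or> (\<forall>n\<ge>N. g n < 0)"
proof (cases "\<exists>M\<ge>N. g M > 0")
  case True
  then obtain M where M: "M \<ge> N" "g M > 0" by auto
  have "g n > 0" if "n \<ge> M" for n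
    using that
  proof (induction rule: dec_induct)
    case (step n)
    thus ?case using assms(1)[of n] nz[of "Suc n"] M(1) by force
  qed (rule M(2))
  thus ?thesis using M(1) by blast
next
  case False
  thus ?thesis using nz by (meson linorder_neqE)
qed

theorem theorem3p1:
  shows "infinite {n :: nat. real (prime_pi n) = real n / real_of_int \<lfloor>ln (real n) - 1/2\<rfloor>}"
proof
  assume "finite {n :: nat. real (prime_pi n) = real n / real_of_int \<lfloor>ln (real n) - 1/2\<rfloor>}" (is "finite ?A")
  then obtain N0 where N0: "\<forall>n\<in>?A. n < N0"
    unfolding finite_nat_set_iff_bounded ..
  \<comment> \<open>Beyond N no solution is left, n is positive, and \<open>block 1 \<le> n\<close>
    makes the floor at least 1, so that \<open>inv_floor\<close> is the true reciprocal.\<close>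
  define N where "N = max N0 (max 1 (block 1))"
  have lf: "log_floor n \<ge> 1" if "n \<ge> N" for n
    using log_floor_ge_iff[of 1 n] that by (simp add: N_def)
  define g where "g = (\<lambda>n. int (prime_pi n) * log_floor n - int n)"
  have excess: "excess n = - real_of_int (g n) / real_of_int (log_floor n)" if "n \<ge> N" for n
    using lf[OF that] by (simp add: excess_def inv_floor_def g_def field_simps)
  have nz: "g n \<noteq> 0" if n: "n \<ge> N" for n
  proof
    assume "g n = 0"
    hence "int (prime_pi n) * log_floor n = int n" by (simp add: g_def)
    hence "real (prime_pi n) * real_of_int (log_floor n) = real n"
      by (metis of_int_mult of_int_of_nat_eq)
    hence "real (prime_pi n) = real n / real_of_int (log_floor n)" using lf[OF n] by (simp add: field_simps)
    hence "n \<in> ?A" by (simp add: log_floor_def)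
    from bspec[OF N0 this] show False using n by (simp add: N_def)
  qed
  have step: "g (Suc n) \<ge> g n - 1" if n: "n \<ge> N" for n
  proof -
    have "ln (real n) \<le> ln (real (Suc n))" using n by (intro ln_mono) (auto simp: N_def)
    hence "log_floor n \<le> log_floor (Suc n)" unfolding log_floor_def by (intro floor_mono) simp
    \<comment> \<open>Both factors are nonnegative and nondecreasing, so g can lose only the 1
      coming from its term -n.\<close>
    hence "int (prime_pi n) * log_floor n \<le> int (prime_pi (Suc n)) * log_floor (Suc n)"
      using lf[OF n] by (intro mult_mono) (auto simp: prime_pi_Suc)
    thus ?thesis by (simp add: g_def)
  qed
  from int_seq_one_sided[of N g, OF step nz] show False
  proof
    assume "\<exists>M\<ge>N. \<forall>n\<ge>M. g n > 0"
    then obtain M where M: "M \<ge> N" "\<And>n. n \<ge> M \<Longrightarrow> g n > 0" by blast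
    have "(-1) * excess n \<ge> 0" if "n \<ge> M" for n
      using excess[of n] lf[of n] M(1) M(2)[OF that] that by simp
    thus False using excess_not_one_sided[of "-1" M] by blast
  next
    assume g: "\<forall>n\<ge>N. g n < 0"
    have "1 * excess n \<ge> 0" if "n \<ge> N" for n
      using excess[OF that] lf[OF that] g[rule_format, OF that] by (simp add: divide_nonpos_pos)
    thus False using excess_not_one_sided[of 1 N] by blast
  qed
qed

end
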